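(* For any lattice $\Lambda\subset\mathbb{R}^n$, let $\sigma_1(\Lambda):=\min_{\lambda\in\Lambda,\,\lambda\ne 0}\|\lambda\|_1$ denote the length of its shortest non-zero vector in the $\ell_1$ norm, and let $\rho_1(\Lambda^* ):=\max_{v\in\mathbb{R}^n}\min_{\lambda\in\Lambda^*}\|\lambda-v\|_1$ denote the covering radius of its dual lattice in the $\ell_1$ norm. Then $$\sigma_1(\Lambda)\,\rho_1(\Lambda^* )\ <\ 0.154264\, n^2\left(1+2\pi\sqrt{\tfrac{3}{n}}\right)^2.$$
   Context: A lattice $\Lambda\subset\mathbb{R}^n$ is the set of integral linear combinations of some basis of $\mathbb{R}^n$; its dual is $\Lambda^*=\{x\in\mathbb{R}^n: x\cdot\lambda\in\mathbb{Z}\ \text{for all }\lambda\in\Lambda\}$. $\|x\|_1=|x_1|+\cdots+|x_n|$. *)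

theory Defs
  imports "HOL-Analysis.Analysis"
begin

definition is_lattice :: "(real ^ 'n) set \<Rightarrow> bool" where
  "is_lattice L \<longleftrightarrow>
     (\<exists>B. independent B \<and> span B = UNIV \<and>
          L = {(\<Sum>b\<in>B. of_int (c b) *\<^sub>R b) | c :: real ^ 'n \<Rightarrow> int. True})"

definition dual_lattice :: "(real ^ 'n) set \<Rightarrow> (real ^ 'n) set" where
  "dual_lattice L = {x. \<forall>l\<in>L. x \<bullet> l \<in> \<int>}"

definition l1_norm :: "real ^ 'n \<Rightarrow> real" where
  "l1_norm x = (\<Sum>i\<in>UNIV. \<bar>x $ i\<bar>)"

(* Minima and maxima over infinite sets are written as infima and suprema. For a lattice
   (and its dual) they are attained: see sigma1_attained, dist1_attained, rho1_attained. *)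

definition sigma1 :: "(real ^ 'n) set \<Rightarrow> real" where
  "sigma1 L = (INF l \<in> L - {0}. l1_norm l)"

definition dist1 :: "(real ^ 'n) set \<Rightarrow> real ^ 'n \<Rightarrow> real" where
  "dist1 M v = (INF l \<in> M. l1_norm (l - v))"

definition rho1 :: "(real ^ 'n) set \<Rightarrow> real" where
  "rho1 M = (SUP v. dist1 M v)"

definition int_vecs :: "(real ^ 'n) set" where
  "int_vecs = {z. \<forall>i. z $ i \<in> \<int>}"

lemma is_lattice_linear_image:
  fixes L :: "(real ^ 'n) set"
  assumes "is_lattice L"
  obtains f :: "real ^ 'n \<Rightarrow> real ^ 'n" where "linear f" "inj f" "surj f" "L = f ` int_vecs"
proof -
  obtain B where B: "independent B" "span B = UNIV"
      and L: "L = {(\<Sum>b\<in>B. of_int (c b) *\<^sub>R b) | c :: real ^ 'n \<Rightarrow> int. True}"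
    using assms unfolding is_lattice_def by blast
  have fin: "finite B" using B(1) by (simp add: independent_imp_finite)
  have "card B = CARD('n)"
    using B dim_eq_card_independent[OF B(1)] dim_span[of B] by simp
  then obtain h where h: "bij_betw h (UNIV :: 'n set) B"
    using fin finite_same_card_bij[of "UNIV :: 'n set" B] by auto
  define f where "f = (\<lambda>z :: real ^ 'n. \<Sum>i\<in>UNIV. (z $ i) *\<^sub>R h i)"
  have lin: "linear f"
    by (rule linearI) (auto simp: f_def sum.distrib scaleR_add_left scaleR_sum_right)
  have reind: "(\<Sum>b\<in>B. u b *\<^sub>R b) = f (\<chi> i. u (h i))" for u
    unfolding f_def using sum.reindex_bij_betw[OF h, of "\<lambda>b. u b *\<^sub>R b"] by simp
  have surj: "surj f"
  proof -
    have "y \<in> range f" for y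
    proof -
      have "y \<in> span B" using B(2) by simp
      then obtain u where "y = (\<Sum>b\<in>B. u b *\<^sub>R b)"
        using span_finite[OF fin] by auto
      then show ?thesis using reind by auto
    qed
    then show ?thesis by auto
  qed
  have inj: "inj f" using linear_surjective_imp_injective[OF lin surj] by simp
  have "L = f ` int_vecs"
  proof
    show "L \<subseteq> f ` int_vecs"
    proof
      fix x assume "x \<in> L"
      then obtain c :: "real ^ 'n \<Rightarrow> int" where "x = (\<Sum>b\<in>B. of_int (c b) *\<^sub>R b)"
        using L by auto
      then have "x = f (\<chi> i. of_int (c (h i)))" using reind[of "\<lambda>b. of_int (c b)"] by simp
      then show "x \<in> f ` int_vecs" by (auto simp: int_vecs_def)
    qed
    show "f ` int_vecs \<subseteq> L"
    proof
      fix x assume "x \<in> f ` int_vecs"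
      then obtain z where z: "x = f z" "\<And>i. z $ i \<in> \<int>" by (auto simp: int_vecs_def)
      define c where "c = (\<lambda>b. \<lfloor>z $ (inv_into UNIV h b)\<rfloor>)"
      have "inj h" using h by (simp add: bij_betw_def)
      then have "(\<chi> i. of_int (c (h i))) = z"
        using z(2) by (simp add: c_def vec_eq_iff of_int_floor_cancel)
      then have "x = (\<Sum>b\<in>B. of_int (c b) *\<^sub>R b)"
        using reind[of "\<lambda>b. of_int (c b)"] z(1) by simp
      then show "x \<in> L" using L by blast
    qed
  qed
  with lin inj surj that show thesis by blast
qed

lemma dual_lattice_linear_image:
  fixes L :: "(real ^ 'n) set"
  assumes "is_lattice L"
  obtains g :: "real ^ 'n \<Rightarrow> real ^ 'n"
    where "linear g" "inj g" "surj g" "dual_lattice L = g ` int_vecs"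
proof -
  obtain f :: "real ^ 'n \<Rightarrow> real ^ 'n"
    where f: "linear f" "inj f" "surj f" "L = f ` int_vecs"
    using is_lattice_linear_image[OF assms] .
  define a where "a = adjoint f"
  have a: "x \<bullet> f y = a x \<bullet> y" for x y
    unfolding a_def using adjoint_works[OF f(1)] by (simp add: inner_commute)
  have lin: "linear a" unfolding a_def by (rule adjoint_linear[OF f(1)])
  have inj: "inj a"
  proof (rule injI)
    fix x y assume "a x = a y"
    then have "x \<bullet> f z = y \<bullet> f z" for z by (simp add: a)
    then have "x \<bullet> w = y \<bullet> w" for w using f(3) by (metis surj_def)
    then show "x = y" using vector_eq_ldot by (metis inner_commute)
  qed
  have surj: "surj a" using linear_injective_imp_surjective[OF lin inj] by simp
  have dual: "dual_lattice L = {x. a x \<in> int_vecs}"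
  proof -
    have "(\<forall>z\<in>int_vecs. w \<bullet> z \<in> \<int>) \<longleftrightarrow> w \<in> int_vecs" for w :: "real ^ 'n"
    proof
      assume *: "\<forall>z\<in>int_vecs. w \<bullet> z \<in> \<int>"
      have "w $ i \<in> \<int>" for i
      proof -
        have "axis i 1 \<in> (int_vecs :: (real ^ 'n) set)" by (auto simp: int_vecs_def axis_def)
        then have "w \<bullet> axis i 1 \<in> \<int>" using * by blast
        then show ?thesis by (simp add: inner_axis)
      qed
      then show "w \<in> int_vecs" by (simp add: int_vecs_def)
    next
      assume "w \<in> int_vecs"
      then show "\<forall>z\<in>int_vecs. w \<bullet> z \<in> \<int>"
        by (auto simp: int_vecs_def inner_vec_def intro!: Ints_sum)
    qed
    then show ?thesis unfolding dual_lattice_def f(4) by (auto simp: a)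
  qed
  have inv: "linear (inv a)"
    using inj_linear_imp_inv_linear[OF lin inj] .
  have b: "bij a" using inj surj by (simp add: bij_def)
  have "bij (inv a)" using bij_imp_bij_inv[OF b] .
  moreover have "dual_lattice L = inv a ` int_vecs"
    unfolding dual using bij_vimage_eq_inv_image[OF b, of int_vecs] by (simp add: vimage_def)
  ultimately show thesis using that[OF inv] by (simp add: bij_def)
qed

lemma closed_int_vecs: "closed (int_vecs :: (real ^ 'n) set)"
proof -
  have "(int_vecs :: (real ^ 'n) set) = (\<Inter>i. (\<lambda>z. z $ i) -` \<int>)"
    by (auto simp: int_vecs_def)
  moreover have "closed (\<Inter>i. (\<lambda>z :: real ^ 'n. z $ i) -` \<int>)"
    by (intro closed_INT ballI closed_vimage closed_Ints continuous_intros)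
  ultimately show ?thesis by simp
qed

lemma closed_int_vecs_nonzero: "closed (int_vecs - {0} :: (real ^ 'n) set)"
proof -
  have "(int_vecs - {0} :: (real ^ 'n) set) = int_vecs \<inter> (\<Union>i. {z. 1 \<le> \<bar>z $ i\<bar>})"
  proof -
    have "\<exists>i. 1 \<le> \<bar>z $ i\<bar>" if z: "z \<in> int_vecs" "z \<noteq> 0" for z :: "real ^ 'n"
    proof -
      obtain i where "z $ i \<noteq> 0" using z(2) by (auto simp: vec_eq_iff)
      then have "1 \<le> \<bar>z $ i\<bar>" using z(1) Ints_nonzero_abs_ge1 by (auto simp: int_vecs_def)
      then show ?thesis by blast
    qed
    then show ?thesis by auto
  qed
  moreover have "closed (\<Union>i. {z :: real ^ 'n. 1 \<le> \<bar>z $ i\<bar>})"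
    by (intro closed_UN finite ballI closed_Collect_le continuous_intros)
  ultimately show ?thesis using closed_int_vecs by auto
qed

lemma l1_norm_nonneg: "0 \<le> l1_norm x"
  by (simp add: l1_norm_def sum_nonneg)

lemma l1_norm_triangle: "l1_norm (x + y) \<le> l1_norm x + l1_norm y"
  unfolding l1_norm_def sum.distrib[symmetric] by (rule sum_mono) simp

lemma continuous_on_l1_norm: "continuous_on S (\<lambda>x. l1_norm (x - v))"
  unfolding l1_norm_def by (intro continuous_intros)

lemma closed_l1_attained:
  fixes S :: "(real ^ 'n) set"
  assumes "closed S" "S \<noteq> {}"
  shows "\<exists>s\<in>S. \<forall>t\<in>S. l1_norm (s - v) \<le> l1_norm (t - v)"
proof -
  obtain s0 where s0: "s0 \<in> S" using assms(2) by auto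
  define K where "K = S \<inter> {x. l1_norm (x - v) \<le> l1_norm (s0 - v)}"
  have "closed {x. l1_norm (x - v) \<le> l1_norm (s0 - v)}"
    by (intro closed_Collect_le continuous_on_l1_norm continuous_intros)
  then have "closed K" using assms(1) by (auto simp: K_def)
  moreover have "bounded K"
  proof -
    have "K \<subseteq> cball v (l1_norm (s0 - v))"
    proof
      fix x assume "x \<in> K"
      moreover have "norm (x - v) \<le> l1_norm (x - v)"
        using norm_le_l1_cart[of "x - v"] by (simp add: l1_norm_def)
      ultimately show "x \<in> cball v (l1_norm (s0 - v))"
        by (simp add: K_def dist_norm norm_minus_commute)
    qed
    then show ?thesis using bounded_cball bounded_subset by blast
  qed
  ultimately have "compact K" by (simp add: compact_eq_bounded_closed)
  moreover have "K \<noteq> {}" using s0 by (auto simp: K_def)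
  ultimately obtain s where s: "s \<in> K" "\<forall>t\<in>K. l1_norm (s - v) \<le> l1_norm (t - v)"
    using continuous_attains_inf[OF _ _ continuous_on_l1_norm] by blast
  have "l1_norm (s - v) \<le> l1_norm (t - v)" if "t \<in> S" for t
    using s that by (cases "t \<in> K") (auto simp: K_def)
  then show ?thesis using s(1) by (auto simp: K_def)
qed

lemma INF_eq_attained:
  fixes f :: "'a \<Rightarrow> real"
  assumes "s \<in> S" "\<forall>t\<in>S. f s \<le> f t"
  shows "(INF t\<in>S. f t) = f s"
  using assms by (intro cInf_eq_minimum) auto

theorem sigma1_attained:
  fixes L :: "(real ^ 'n) set"
  assumes "is_lattice L"
  shows "\<exists>l \<in> L - {0}. sigma1 L = l1_norm l \<and> (\<forall>m \<in> L - {0}. l1_norm l \<le> l1_norm m)"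
proof -
  obtain f :: "real ^ 'n \<Rightarrow> real ^ 'n"
    where f: "linear f" "inj f" "surj f" "L = f ` int_vecs"
    using is_lattice_linear_image[OF assms] .
  have eq: "L - {0} = f ` (int_vecs - {0})"
    using f(4) image_set_diff[OF f(2), of int_vecs "{0}"] linear_0[OF f(1)] by simp
  then have "closed (L - {0})"
    using closed_injective_linear_image[OF closed_int_vecs_nonzero f(1,2)] by simp
  moreover have "axis undefined 1 \<in> (int_vecs - {0} :: (real ^ 'n) set)"
    by (auto simp: int_vecs_def axis_def vec_eq_iff)
  then have "L - {0} \<noteq> {}" using eq by blast
  ultimately obtain l where l: "l \<in> L - {0}" "\<forall>m\<in>L - {0}. l1_norm l \<le> l1_norm m"
    using closed_l1_attained[of "L - {0}" 0] by auto
  then show ?thesis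
    unfolding sigma1_def using INF_eq_attained[of l "L - {0}" l1_norm] by blast
qed

theorem dist1_attained:
  fixes L :: "(real ^ 'n) set"
  assumes "is_lattice L"
  shows "\<exists>l \<in> dual_lattice L. dist1 (dual_lattice L) v = l1_norm (l - v)
           \<and> (\<forall>m \<in> dual_lattice L. l1_norm (l - v) \<le> l1_norm (m - v))"
proof -
  obtain g :: "real ^ 'n \<Rightarrow> real ^ 'n"
    where g: "linear g" "inj g" "surj g" "dual_lattice L = g ` int_vecs"
    using dual_lattice_linear_image[OF assms] .
  have "closed (dual_lattice L)"
    using closed_injective_linear_image[OF closed_int_vecs g(1,2)] g(4) by simp
  moreover have "dual_lattice L \<noteq> {}" by (auto simp: dual_lattice_def intro!: exI[of _ 0])
  ultimately obtain l where l: "l \<in> dual_lattice L"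
      "\<forall>m\<in>dual_lattice L. l1_norm (l - v) \<le> l1_norm (m - v)"
    using closed_l1_attained by blast
  then show ?thesis
    unfolding dist1_def using INF_eq_attained[of l _ "\<lambda>l. l1_norm (l - v)"] by blast
qed

theorem rho1_attained:
  fixes L :: "(real ^ 'n) set"
  assumes "is_lattice L"
  shows "\<exists>v. rho1 (dual_lattice L) = dist1 (dual_lattice L) v
           \<and> (\<forall>w. dist1 (dual_lattice L) w \<le> dist1 (dual_lattice L) v)"
proof -
  define M where "M = dual_lattice L"
  define d where "d = dist1 M"
  obtain g :: "real ^ 'n \<Rightarrow> real ^ 'n"
    where g: "linear g" "inj g" "surj g" "M = g ` int_vecs"
    unfolding M_def using dual_lattice_linear_image[OF assms] .
  have att: "\<exists>l\<in>M. d v = l1_norm (l - v)" for v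
    unfolding d_def M_def using dist1_attained[OF assms] by blast
  have low: "d v \<le> l1_norm (m - v)" if "m \<in> M" for m v
    using that dist1_attained[OF assms, of v] unfolding d_def M_def by metis
  have step: "d w \<le> d v + l1_norm (v - w)" for v w
  proof -
    obtain l where l: "l \<in> M" "d v = l1_norm (l - v)" using att by blast
    have "d w \<le> l1_norm (l - w)" using low l(1) .
    also have "\<dots> \<le> l1_norm (l - v) + l1_norm (v - w)"
      using l1_norm_triangle[of "l - v" "v - w"] by simp
    finally show ?thesis using l by simp
  qed
  have sym: "l1_norm (v - w) = l1_norm (w - v)" for v w :: "real ^ 'n"
    by (simp add: l1_norm_def abs_minus_commute)
  have cont: "continuous_on UNIV d"
  proof -
    have "(d \<longlongrightarrow> d v) (at v)" for v
    proof -
      have "((\<lambda>w. l1_norm (w - v)) \<longlongrightarrow> 0) (at v)"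
        using continuous_on_l1_norm[of UNIV v]
        by (auto simp: continuous_on_def l1_norm_def dest!: spec[of _ v])
      moreover have "norm (d w - d v) \<le> l1_norm (w - v)" for w
        using step[of w v] step[of v w] sym[of v w] by (simp add: abs_le_iff)
      ultimately have "((\<lambda>w. d w - d v) \<longlongrightarrow> 0) (at v)"
        by (intro Lim_null_comparison[of "\<lambda>w. d w - d v" "\<lambda>w. l1_norm (w - v)"]) auto
      then show ?thesis by (simp add: LIM_zero_iff)
    qed
    then show ?thesis by (simp add: continuous_on_def)
  qed
  define K where "K = g ` cbox 0 (\<chi> i. 1)"
  have "compact K"
    unfolding K_def using g(1)
    by (intro compact_continuous_image compact_cbox linear_continuous_on)
       (simp add: linear_conv_bounded_linear)
  moreover have "K \<noteq> {}" by (auto simp: K_def cbox_interval less_eq_vec_def)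
  ultimately obtain v where v: "\<And>w. w \<in> K \<Longrightarrow> d w \<le> d v"
    using continuous_attains_sup[of K d] continuous_on_subset[OF cont, of K] by auto
  have max: "d w \<le> d v" for w
  proof -
    obtain z where z: "w = g z" using g(3) by (metis surj_def)
    define p :: "real ^ 'n" where "p = (\<chi> i. of_int \<lfloor>z $ i\<rfloor>)"
    have pM: "p \<in> int_vecs" by (simp add: p_def int_vecs_def)
    have "z - p \<in> cbox 0 (\<chi> i. 1)"
      by (auto simp: mem_box_cart p_def intro: order_less_imp_le) linarith
    then have K: "g (z - p) \<in> K" by (simp add: K_def)
    obtain l where l: "l \<in> M" "d (g (z - p)) = l1_norm (l - g (z - p))" using att by blast
    obtain q where q: "q \<in> int_vecs" "l = g q" using l(1) g(4) by auto
    have "q + p \<in> int_vecs" using q(1) pM by (simp add: int_vecs_def)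
    then have "g (q + p) \<in> M" using g(4) by blast
    then have "d w \<le> l1_norm (g (q + p) - w)" by (rule low)
    also have "g (q + p) - w = l - g (z - p)"
      by (simp add: q z linear_add[OF g(1)] linear_diff[OF g(1)])
    finally show ?thesis using l v[OF K] by simp
  qed
  then have "rho1 M = d v"
    unfolding rho1_def d_def by (intro cSup_eq_maximum) auto
  then show ?thesis using max unfolding d_def M_def by blast
qed

end

theory Submission
  imports Defs "HOL-Complex_Analysis.Complex_Analysis" "HOL-Real_Asymp.Real_Asymp"
begin

text \<open>
  Let \<open>M\<close> be the dual of the lattice \<open>L\<close> in dimension \<open>n\<close>. The proof follows Banaszczyk's method of
  estimating lattice sums of a positive function whose Fourier transform is positive too, with test
  functions that suit the \<open>l1\<close> norm. Put
  \<open>g x = 1 / cosh\<^sup>2 x\<close>, whose transform is \<open>gh y = 2 \<pi>\<^sup>2 y / sinh (\<pi>\<^sup>2 y)\<close>, let \<open>G\<close> and \<open>Gh\<close> be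
  their \<open>n\<close>-fold tensor products and let \<open>\<theta> v\<close> be the sum of \<open>G (m + v)\<close> over \<open>m \<in> M\<close>. By Poisson
  summation \<open>\<theta> v\<close> is \<open>D\<close> times the sum of \<open>Gh l * cos (2 \<pi> (v \<bullet> l))\<close> over \<open>l \<in> L\<close>, where \<open>D\<close> is
  the covolume of \<open>L\<close>. Two consequences carry the argument (\<open>poisson_at_0\<close>, \<open>poisson_deviation\<close>):
  \<open>\<theta> 0\<close> is exactly \<open>D\<close> times the sum of \<open>Gh\<close> over \<open>L\<close>, and \<open>\<theta> v\<close> differs from the contribution
  \<open>D * Gh 0\<close> of the zero frequency by at most \<open>\<theta> 0 - D * Gh 0\<close>.

  Suppose that both \<open>\<sigma>\<close>, the shortest length in \<open>L\<close>, and \<open>\<rho>\<close>, the covering radius of \<open>M\<close>, are large,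
  and let \<open>v\<close> be a point at distance \<open>\<rho>\<close> from \<open>M\<close>. Then \<open>\<theta> (- v)\<close> is a sum of values of \<open>G\<close> far
  from the origin, hence a small fraction of \<open>\<theta> 0\<close> (\<open>shifted_tail\<close>). Likewise all nonzero frequencies
  are far from the origin, so \<open>\<theta> 0 - D * Gh 0\<close> is a small fraction of \<open>\<theta> 0\<close> (\<open>nonzero_tail\<close>). These
  statements are incompatible: the second forces \<open>\<theta>\<close> to be nearly constant, the first makes it small
  at one point (\<open>no_gap_in_both\<close>).

  Both tail estimates compare the sum with the sum over a rescaled lattice. In one variable
  \<open>h x \<le> h (s x) * s powr (- b) * exp (- a (1 - s) \<bar>x\<bar>)\<close> for \<open>0 < s \<le> 1\<close>, so that \<open>n\<close> factors at
  \<open>l1\<close> distance \<open>R\<close> gain \<open>s powr (- b n) * exp (- a (1 - s) R)\<close>, whereas by Poisson summation passing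
  to the rescaled lattice costs at most \<open>s powr (- n)\<close>. With \<open>R = (1 + b) / a * n * \<lambda>\<close> and \<open>s = 1 / \<lambda>\<close>
  the total is \<open>exp (- (1 + b) n (\<lambda> - 1 - ln \<lambda>))\<close>, which is small as soon as \<open>\<lambda>\<close> exceeds \<open>1\<close> by a
  sufficiently large multiple of \<open>1 / sqrt n\<close>; \<open>\<lambda> = (1 + 2 / sqrt n)\<^sup>2\<close> is enough.
  The quantity \<open>(1 + b) / a\<close> is \<open>0.78\<close> for \<open>g\<close> and \<open>1.95 / \<pi>\<^sup>2\<close> for \<open>gh\<close>. Their product
  \<open>1.521 / \<pi>\<^sup>2\<close> lies just below \<open>0.154264\<close>; this is the reason for the choice of \<open>g\<close>, because the more
  symmetric self-dual function \<open>1 / cosh (\<pi> x)\<close> leads to the larger value \<open>0.166\<close>.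
\<close>

section \<open>Lebesgue measure on coordinate space\<close>

text \<open>Fubini's theorem for products of functions of one coordinate each, transported from the abstract
  product measure that underlies \<open>lborel\<close> on a Euclidean space.\<close>
lemma lborel_prod_vec:
  fixes \<phi> :: "'n::finite \<Rightarrow> real \<Rightarrow> 'a :: {real_normed_field, banach, second_countable_topology}"
  assumes int: "\<And>i. integrable lborel (\<phi> i)"
  shows integrable_prod_vec: "integrable lborel (\<lambda>x :: real^'n. \<Prod>i\<in>UNIV. \<phi> i (x $ i))"
    and integral_prod_vec: "(\<integral>x. (\<Prod>i\<in>UNIV. \<phi> i (x $ i)) \<partial>(lborel :: (real^'n) measure)) = (\<Prod>i\<in>UNIV. \<integral>t. \<phi> i t \<partial>lborel)"
proof -
  let ?B = "Basis :: (real^'n) set"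
  let ?a = "\<lambda>i :: 'n. axis i (1::real)"
  have bij: "bij_betw ?a UNIV ?B"
    by (auto simp: bij_betw_def Basis_vec_def inj_on_def axis_eq_axis)
  define \<psi> where "\<psi> = (\<lambda>b. \<phi> (inv_into UNIV ?a b))"
  have inv: "inv_into UNIV ?a (?a i) = i" for i
    using bij by (intro inv_into_f_f) (auto simp: bij_betw_def)
  interpret P: product_sigma_finite "\<lambda>_ :: real^'n. lborel :: real measure" ..
  have prodB: "(\<Prod>i\<in>UNIV. \<phi> i (u (?a i))) = (\<Prod>b\<in>?B. \<psi> b (u b))" for u
    using prod.reindex_bij_betw[OF bij, of "\<lambda>b. \<psi> b (u b)"] by (simp add: \<psi>_def inv)
  have coord: "(\<Sum>b\<in>?B. f b *\<^sub>R b) $ i = f (?a i)" for f i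
  proof -
    have "(\<Sum>b\<in>?B. f b *\<^sub>R b) $ i = (\<Sum>b\<in>?B. f b *\<^sub>R b) \<bullet> ?a i" by (simp add: inner_axis)
    also have "\<dots> = f (?a i)" by (rule inner_sum_left_Basis) (auto simp: Basis_vec_def)
    finally show ?thesis .
  qed
  have int\<psi>: "integrable lborel (\<psi> b)" for b unfolding \<psi>_def by (rule int)
  have meas\<phi>[measurable]: "\<phi> i \<in> borel_measurable borel" for i
    using int[of i] by (simp add: integrable_iff_bounded)
  have meas: "(\<lambda>x :: real^'n. \<Prod>i\<in>UNIV. \<phi> i (x $ i)) \<in> borel_measurable borel"
    by measurable
  have meas2: "(\<lambda>f. \<Sum>b\<in>?B. f b *\<^sub>R b) \<in> measurable (\<Pi>\<^sub>M b\<in>?B. lborel) borel"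
    by measurable
  have eq: "(\<lambda>f. \<Prod>i\<in>UNIV. \<phi> i ((\<Sum>b\<in>?B. f b *\<^sub>R b) $ i)) = (\<lambda>f. \<Prod>b\<in>?B. \<psi> b (f b))"
    unfolding coord prodB ..
  show "integrable lborel (\<lambda>x :: real^'n. \<Prod>i\<in>UNIV. \<phi> i (x $ i))"
    unfolding lborel_eq[where 'a="real^'n"] integrable_distr_eq[OF meas2 meas] eq
    by (rule P.product_integrable_prod) (auto intro: int\<psi>)
  have "(\<integral>x. (\<Prod>i\<in>UNIV. \<phi> i (x $ i)) \<partial>(lborel :: (real^'n) measure)) = (\<Prod>b\<in>?B. \<integral>t. \<psi> b t \<partial>lborel)"
    by (subst lborel_eq[where 'a="real^'n"], subst integral_distr[OF meas2 meas], unfold eq)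
       (rule P.product_integral_prod, auto intro: int\<psi>)
  also have "\<dots> = (\<Prod>i\<in>UNIV. \<integral>t. \<phi> i t \<partial>lborel)"
    using prod.reindex_bij_betw[OF bij, of "\<lambda>b. \<integral>t. \<psi> b t \<partial>lborel"]
    by (simp add: \<psi>_def inv)
  finally show "(\<integral>x. (\<Prod>i\<in>UNIV. \<phi> i (x $ i)) \<partial>(lborel :: (real^'n) measure)) = (\<Prod>i\<in>UNIV. \<integral>t. \<phi> i t \<partial>lborel)" .
qed

lemma nn_integral_lborel_translate:
  fixes c :: "'a::euclidean_space"
  assumes [measurable]: "f \<in> borel_measurable borel"
  shows "(\<integral>\<^sup>+x. f (x + c) \<partial>lborel) = (\<integral>\<^sup>+x. f x \<partial>lborel)"
proof -
  have "(\<integral>\<^sup>+x. f x \<partial>lborel) = (\<integral>\<^sup>+x. f x \<partial>(distr lborel borel ((+) c)))"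
    by (simp add: lborel_distr_plus)
  also have "\<dots> = (\<integral>\<^sup>+x. f (x + c) \<partial>lborel)" by (subst nn_integral_distr) (auto simp: add.commute)
  finally show ?thesis by simp
qed

lemma nn_integral_lborel_scaleR:
  fixes f :: "'a::euclidean_space \<Rightarrow> ennreal"
  assumes c: "c \<noteq> 0" and [measurable]: "f \<in> borel_measurable borel"
  shows "(\<integral>\<^sup>+x. f x \<partial>lborel) = ennreal (\<bar>c\<bar> ^ DIM('a)) * (\<integral>\<^sup>+x. f (c *\<^sub>R x) \<partial>lborel)"
proof -
  have "lborel = density (distr lborel borel (\<lambda>x::'a. 0 + c *\<^sub>R x)) (\<lambda>_. ennreal (\<bar>c\<bar> ^ DIM('a)))"
    by (rule lborel_affine[OF c])
  then have "(\<integral>\<^sup>+x. f x \<partial>lborel) = (\<integral>\<^sup>+x. f x \<partial>density (distr lborel borel (\<lambda>x::'a. c *\<^sub>R x)) (\<lambda>_. ennreal (\<bar>c\<bar> ^ DIM('a))))"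
    by simp
  also have "\<dots> = ennreal (\<bar>c\<bar> ^ DIM('a)) * (\<integral>\<^sup>+x. f (c *\<^sub>R x) \<partial>lborel)"
    by (simp add: nn_integral_density nn_integral_distr nn_integral_cmult)
  finally show ?thesis .
qed

text \<open>The image of Lebesgue measure under an invertible linear map is translation invariant, and a translation
  invariant measure \<open>\<mu>\<close> that is also invariant under \<open>x \<mapsto> - x\<close> is proportional to Lebesgue measure \<open>\<lambda>\<close>:
  integrating \<open>indicator A x * indicator B (y - x)\<close> first over \<open>y\<close> gives \<open>\<mu> A * \<lambda> B\<close>, while replacing
  \<open>x\<close> by \<open>y - x\<close> and integrating first over \<open>y\<close> again gives \<open>\<mu> B * \<lambda> A\<close>. The factor \<open>D\<close> is
  \<open>1 / \<bar>det T\<bar>\<close>.\<close>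
lemma distr_lborel_linear:
  fixes T S :: "'a::euclidean_space \<Rightarrow> 'a"
  assumes lin: "linear T" "linear S" and inv: "\<And>x. T (S x) = x" "\<And>x. S (T x) = x"
  obtains D where "0 < D" "distr lborel borel T = density lborel (\<lambda>_. ennreal D)"
proof -
  have cont: "continuous_on A T" "continuous_on A S" for A
    using lin by (auto intro: linear_continuous_on simp: linear_conv_bounded_linear)
  have [measurable]: "T \<in> borel_measurable borel" "S \<in> borel_measurable borel"
    by (auto intro: borel_measurable_continuous_onI cont)
  let ?I = "\<lambda>f. \<integral>\<^sup>+w. f (T w) \<partial>lborel"
  let ?Q = "cbox 0 One :: 'a set"
  have Q[measurable]: "?Q \<in> sets borel" by simp
  have Q1: "emeasure lborel ?Q = 1"
    by (simp add: emeasure_lborel_cbox_eq)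
  have refl: "(\<integral>\<^sup>+w. f (- w) \<partial>lborel) = (\<integral>\<^sup>+w. f w \<partial>lborel)" if [measurable]: "f \<in> borel_measurable borel"
    for f :: "'a \<Rightarrow> ennreal"
    using nn_integral_lborel_scaleR[of "-1" f] by simp
  have ind[measurable]: "(indicator X :: 'a \<Rightarrow> ennreal) \<in> borel_measurable borel" if "X \<in> sets borel" for X
    using that by simp
  have key: "?I (indicator A) * emeasure lborel B = ?I (indicator B) * emeasure lborel A"
    if [measurable]: "A \<in> sets borel" "B \<in> sets borel" for A B
  proof -
    have tr: "(\<integral>\<^sup>+w. f (y - T w) \<partial>lborel) = ?I f" if [measurable]: "f \<in> borel_measurable borel" for f :: "'a \<Rightarrow> ennreal" and y
    proof -
      have "(\<integral>\<^sup>+w. f (y - T w) \<partial>lborel) = (\<integral>\<^sup>+w. f (T (S y - w)) \<partial>lborel)"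
        by (simp add: linear_diff[OF lin(1)] inv)
      also have "\<dots> = (\<integral>\<^sup>+w. f (T (S y + w)) \<partial>lborel)"
        using refl[of "\<lambda>w. f (T (S y + w))"] by simp
      also have "\<dots> = ?I f"
        using nn_integral_lborel_translate[of "\<lambda>w. f (T w)" "S y"] by (simp add: add.commute)
      finally show ?thesis .
    qed
    have shift: "(\<integral>\<^sup>+y. indicator B y \<partial>lborel) = (\<integral>\<^sup>+y. indicator B (y - x) \<partial>lborel)" for x
      using nn_integral_lborel_translate[of "indicator B" "- x"] by simp
    have "?I (indicator A) * emeasure lborel B
        = (\<integral>\<^sup>+w. indicator A (T w) * (\<integral>\<^sup>+y. indicator B y \<partial>lborel) \<partial>lborel)"
      by (subst nn_integral_multc) auto
    also have "\<dots> = (\<integral>\<^sup>+w. (\<integral>\<^sup>+y. indicator A (T w) * indicator B (y - T w) \<partial>lborel) \<partial>lborel)"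
    proof (rule nn_integral_cong)
      fix w
      show "indicator A (T w) * (\<integral>\<^sup>+y. indicator B y \<partial>lborel)
          = (\<integral>\<^sup>+y. indicator A (T w) * indicator B (y - T w) \<partial>lborel)"
        unfolding shift[of "T w"] by (rule nn_integral_cmult[symmetric]) measurable
    qed
    also have "\<dots> = (\<integral>\<^sup>+y. (\<integral>\<^sup>+w. indicator A (T w) * indicator B (y - T w) \<partial>lborel) \<partial>lborel)"
      by (rule lborel_pair.Fubini') measurable
    also have "\<dots> = (\<integral>\<^sup>+y. (\<integral>\<^sup>+w. indicator A (y - T w) * indicator B (T w) \<partial>lborel) \<partial>lborel)"
    proof (rule nn_integral_cong)
      fix y
      show "(\<integral>\<^sup>+w. indicator A (T w) * indicator B (y - T w) \<partial>lborel)
          = (\<integral>\<^sup>+w. indicator A (y - T w) * indicator B (T w) \<partial>lborel)"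
        using tr[of "\<lambda>x. indicator A x * indicator B (y - x)" y] by simp
    qed
    also have "\<dots> = (\<integral>\<^sup>+w. (\<integral>\<^sup>+y. indicator A (y - T w) * indicator B (T w) \<partial>lborel) \<partial>lborel)"
      by (rule lborel_pair.Fubini'[symmetric]) measurable
    also have "\<dots> = (\<integral>\<^sup>+w. (\<integral>\<^sup>+y. indicator A y \<partial>lborel) * indicator B (T w) \<partial>lborel)"
      using nn_integral_lborel_translate[of "indicator A" "- _"]
      by (subst nn_integral_multc) (auto intro!: nn_integral_cong)
    also have "\<dots> = ?I (indicator B) * emeasure lborel A"
      by (subst nn_integral_cmult) (auto simp: mult.commute)
    finally show ?thesis .
  qed
  define d where "d = ?I (indicator ?Q)"
  have d_eq: "d = emeasure lborel (S ` ?Q)"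
  proof -
    have "(\<lambda>w. indicator ?Q (T w) :: ennreal) = indicator (S ` ?Q)"
      by (rule ext) (smt (verit) image_iff indicator_simps inv)
    moreover have "compact (S ` ?Q)" by (intro compact_continuous_image cont) auto
    then have "S ` ?Q \<in> sets lborel" by (simp add: compact_imp_closed borel_closed)
    ultimately show ?thesis by (simp add: d_def)
  qed
  have "bounded (S ` ?Q)" by (intro compact_imp_bounded compact_continuous_image cont) auto
  then have fin: "d < \<infinity>"
    unfolding d_eq by (metis bounded_subset_cbox_symmetric cbox_borel emeasure_lborel_cbox_finite emeasure_mono order_le_less_trans sets_lborel)
  have "d \<noteq> 0"
  proof
    assume "d = 0"
    have "?I (indicator UNIV) * emeasure lborel ?Q = d * emeasure lborel (UNIV :: 'a set)"
      unfolding d_def by (rule key) auto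
    then show False using Q1 \<open>d = 0\<close> by simp
  qed
  define D where "D = enn2real d"
  have D: "0 < D" "ennreal D = d"
    using fin \<open>d \<noteq> 0\<close> by (auto simp: D_def enn2real_positive_iff zero_less_iff_neq_zero)
  have "distr lborel borel T = density lborel (\<lambda>_. ennreal D)"
  proof (rule measure_eqI)
    fix A assume "A \<in> sets (distr lborel borel T)"
    then have A[measurable]: "A \<in> sets borel" by simp
    have "emeasure (distr lborel borel T) A = ?I (indicator A)"
      using nn_integral_distr[of T lborel borel "indicator A"] by simp
    also have "\<dots> = d * emeasure lborel A"
      using key[OF A Q] Q1 by (simp add: d_def)
    finally show "emeasure (distr lborel borel T) A = emeasure (density lborel (\<lambda>_. ennreal D)) A"
      by (simp add: D emeasure_density_const)
  qed simp
  with D(1) that show thesis by blast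
qed


section \<open>Tiling space by integer translates of a cube\<close>

definition ivec :: "('n \<Rightarrow> int) \<Rightarrow> real ^ 'n" where
  "ivec k = (\<chi> i. of_int (k i))"

lemma ivec_nth [simp]: "ivec k $ i = of_int (k i)"
  by (simp add: ivec_def)

text \<open>Half-open, so that the integer translates form an exact partition, and centred at the origin, which
  is where the Fejer kernels concentrate.\<close>
definition cube :: "(real ^ 'n) set" where
  "cube = {w. \<forall>i. w $ i \<in> {-1/2..<1/2}}"

lemma cube_sets [measurable]: "cube \<in> sets borel"
proof -
  have "(cube :: (real^'n) set) = {w \<in> space borel. \<forall>i. w $ i \<in> {-1/2..<1/2}}" by (simp add: cube_def)
  also have "\<dots> \<in> sets borel" by measurable
  finally show ?thesis .
qed

text \<open>Every point lies in exactly one integer translate of the cube; the rest is an exchange of sum and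
  integral and translation invariance. This turns an integral over the whole space into an integral of
  the periodization over one cell.\<close>
lemma nn_integral_tiling:
  fixes f :: "real ^ 'n \<Rightarrow> ennreal"
  assumes [measurable]: "f \<in> borel_measurable borel"
  shows "(\<integral>\<^sup>+x. f x \<partial>lborel)
    = (\<integral>\<^sup>+w. indicator cube w * (\<integral>\<^sup>+k. f (w + ivec k) \<partial>count_space UNIV) \<partial>lborel)"
proof -
  let ?C = "count_space (UNIV :: ('n \<Rightarrow> int) set)"
  have cell: "(\<integral>\<^sup>+k. indicator cube (x - ivec k) * f x \<partial>?C) = f x" for x :: "real^'n"
  proof -
    define c where "c = (\<lambda>i. \<lfloor>x $ i + 1/2\<rfloor>)"
    have "x - ivec k \<in> cube \<longleftrightarrow> k = c" for k
    proof -
      have "x - ivec k \<in> cube \<longleftrightarrow> (\<forall>i. of_int (k i) \<le> x $ i + 1/2 \<and> x $ i + 1/2 < of_int (k i) + 1)"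
        unfolding cube_def by (simp add: algebra_simps) (smt (verit) field_sum_of_halves)
      also have "\<dots> \<longleftrightarrow> (\<forall>i. c i = k i)" unfolding c_def by (simp add: floor_eq_iff)
      finally show ?thesis by auto
    qed
    then have "(\<lambda>k. indicator cube (x - ivec k) * f x) = (\<lambda>k. f x * indicator {c} k)"
      by (auto simp: fun_eq_iff indicator_def)
    then show ?thesis by (simp add: nn_integral_cmult)
  qed
  have "(\<integral>\<^sup>+x. f x \<partial>lborel) = (\<integral>\<^sup>+x. (\<integral>\<^sup>+k. indicator cube (x - ivec k) * f x \<partial>?C) \<partial>lborel)"
    by (simp add: cell)
  also have "\<dots> = (\<integral>\<^sup>+k. (\<integral>\<^sup>+x. indicator cube (x - ivec k) * f x \<partial>lborel) \<partial>?C)"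
    by (rule nn_integral_count_space_nn_integral) auto
  also have "\<dots> = (\<integral>\<^sup>+k. (\<integral>\<^sup>+w. indicator cube w * f (w + ivec k) \<partial>lborel) \<partial>?C)"
  proof (rule nn_integral_cong)
    fix k
    show "(\<integral>\<^sup>+x. indicator cube (x - ivec k) * f x \<partial>lborel) = (\<integral>\<^sup>+w. indicator cube w * f (w + ivec k) \<partial>lborel)"
      using nn_integral_lborel_translate[of "\<lambda>x. indicator cube (x - ivec k) * f x" "ivec k"] by simp
  qed
  also have "\<dots> = (\<integral>\<^sup>+w. (\<integral>\<^sup>+k. indicator cube w * f (w + ivec k) \<partial>?C) \<partial>lborel)"
    by (rule nn_integral_count_space_nn_integral[symmetric]) auto
  finally show ?thesis by (simp add: nn_integral_cmult)
qed

section \<open>The Fourier transform of the squared hyperbolic secant\<close>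

text \<open>The antiderivative is \<open>tanh\<close>, which increases from \<open>-1\<close> to \<open>1\<close>.\<close>
lemma sech_sq_integral:
  shows integrable_sech_sq: "integrable lborel (\<lambda>x::real. 1 / (cosh x)\<^sup>2)"
    and integral_sech_sq: "(\<integral>x. 1 / (cosh (x::real))\<^sup>2 \<partial>lborel) = 2"
proof -
  let ?u = "\<lambda>x::real. 1 / (cosh x)\<^sup>2"
  let ?f = "\<lambda>n x. ?u x * indicator {- real n..real n} x"
  have der: "DERIV tanh x :> ?u x" for x :: real
  proof -
    have "DERIV tanh x :> 1 - (tanh x)\<^sup>2" by (auto intro!: derivative_eq_intros)
    also have "1 - (tanh x)\<^sup>2 = ?u x"
      using hyperbolic_pythagoras[of x] by (simp add: tanh_def power_divide divide_simps)
    finally show ?thesis .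
  qed
  have m: "?u \<in> borel_measurable borel"
    by (intro borel_measurable_continuous_onI continuous_intros) auto
  have fi: "has_bochner_integral lborel (?f n) (tanh (real n) - tanh (- real n))" for n
    by (rule has_bochner_integral_FTC_Icc_nonneg) (use der m in auto)
  have ind: "((\<lambda>n. ?f n x) \<longlonglongrightarrow> ?u x)" for x
  proof (rule tendsto_eventually)
    obtain N where "\<bar>x\<bar> \<le> real N" using real_arch_simple by blast
    then show "\<forall>\<^sub>F n in sequentially. ?f n x = ?u x"
      by (intro eventually_sequentiallyI[of N]) (auto simp: indicator_def)
  qed
  have lim: "(\<lambda>n. integral\<^sup>L lborel (?f n)) \<longlonglongrightarrow> 2"
  proof -
    have "((\<lambda>n. tanh (real n)) \<longlonglongrightarrow> 1)"
      by (rule filterlim_compose[OF tanh_real_at_top filterlim_real_sequentially])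
    then have "(\<lambda>n. tanh (real n) - tanh (- real n)) \<longlonglongrightarrow> 1 + 1"
      by (simp only: tanh_minus diff_minus_eq_add) (rule tendsto_add)
    then show ?thesis using has_bochner_integral_integral_eq[OF fi] by simp
  qed
  have mono: "AE x in lborel. mono (\<lambda>n. ?f n x)"
    by (auto simp: mono_def indicator_def)
  have i: "integrable lborel (?f n)" for n using fi[of n] by (auto simp: has_bochner_integral_iff)
  show "integrable lborel ?u" "integral\<^sup>L lborel ?u = 2"
    using integrable_monotone_convergence[OF i mono _ lim, of ?u]
      integral_monotone_convergence[OF i mono _ lim, of ?u] ind m by auto
qed

text \<open>In the strip swept by the contour below, \<open>cosh\<close> vanishes only at \<open>\<i> \<pi> / 2\<close>.\<close>
lemma cosh_eq_0_strip:
  fixes z :: complex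
  assumes "- pi / 2 < Im z" "Im z < 3 * pi / 2" "cosh z = 0"
  shows "z = \<i> * (pi / 2)"
proof -
  have "cos (\<i> * z) = 0" using assms(3) by (simp add: cosh_conv_cos)
  then obtain n where n: "\<i> * z = of_int n * complex_of_real pi + of_real pi / 2"
    unfolding cos_eq_0 by auto
  have "z = - \<i> * (\<i> * z)" by simp
  then have z: "Re z = 0" "Im z = - (real_of_int n * pi + pi / 2)" unfolding n by (simp_all add: complex_eq_iff)
  have "0 < (of_int n + 2) * pi" "(of_int n + 0) * pi < 0"
    using assms(1,2) unfolding z by (simp_all add: algebra_simps)
  then have "-2 < n" "n < 0"
    by (simp_all add: zero_less_mult_iff mult_less_0_iff)
  then have "n = -1" by simp
  with z show ?thesis by (simp add: complex_eq_iff)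
qed

text \<open>The growth that makes the vertical sides of the contour negligible.\<close>
lemma norm_cosh_ge: "sinh (Re z) \<le> norm (cosh z)" for z :: complex
proof -
  have "norm (exp z) - norm (exp (-z)) \<le> norm (exp z + exp (-z))"
    using norm_diff_ineq by blast
  then show ?thesis
    by (simp add: cosh_field_def sinh_field_def norm_divide)
qed

text \<open>The integrand has a double pole at \<open>\<i> \<pi> / 2\<close>. Since \<open>exp (\<i> a z) / cosh\<^sup>2 z + \<i> a exp (\<i> a z) tanh z\<close>
  is the derivative of \<open>exp (\<i> a z) tanh z\<close>, its integral over the closed contour vanishes, and the
  double pole is exchanged for the simple pole of \<open>exp (\<i> a z) tanh z\<close>.\<close>
lemma contour_integral_sech_sq_rect:
  fixes a R :: real
  assumes R: "0 < R"
  shows "contour_integral (rectpath (- of_real R) (Complex R pi)) (\<lambda>z. exp (\<i> * a * z) / (cosh z)\<^sup>2)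
    = 2 * pi * a * exp (- pi * a / 2)"
proof -
  define p where "p = \<i> * complex_of_real (pi / 2)"
  define U where "U = {z. - pi / 2 < Im z} \<inter> {z. Im z < 3 * pi / 2}"
  let ?r = "rectpath (- of_real R) (Complex R pi)"
  let ?f = "\<lambda>z. exp (\<i> * a * z) / (cosh z)\<^sup>2"
  let ?t = "\<lambda>z. exp (\<i> * a * z) * sinh z / cosh z"
  have U: "open U" "connected U"
    unfolding U_def
    by (intro open_Int open_halfspace_Im_gt open_halfspace_Im_lt convex_connected convex_Int
        convex_halfspace_Im_gt convex_halfspace_Im_lt)+
  have pU: "p \<in> U" by (auto simp: U_def p_def)
  have nz: "cosh z \<noteq> 0" if "z \<in> U - {p}" for z
    using cosh_eq_0_strip[of z] that by (auto simp: U_def p_def)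
  have strip: "- (pi / 2) < t" "t * 2 < 3 * pi" if "0 \<le> t" "t \<le> pi" for t
    using that pi_gt_zero by linarith+
  have img: "path_image ?r \<subseteq> U - {p}"
    using R strip[of pi]
    by (subst path_image_rectpath) (auto simp: U_def p_def complex_eq_iff intro!: strip)
  have der: "(?t has_field_derivative (?f z + \<i> * a * ?t z)) (at z within U - {p})" if "z \<in> U - {p}" for z
  proof -
    have eq: "(exp (\<i> * a * z) * (\<i> * a) * sinh z + exp (\<i> * a * z) * cosh z) * cosh z - exp (\<i> * a * z) * sinh z * sinh z
        = exp (\<i> * a * z) * ((cosh z)\<^sup>2 - (sinh z)\<^sup>2) + \<i> * a * (exp (\<i> * a * z) * sinh z * cosh z)"
      by (simp add: algebra_simps power2_eq_square)
    have "(?t has_field_derivative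
        ((exp (\<i> * a * z) * (\<i> * a) * sinh z + exp (\<i> * a * z) * cosh z) * cosh z - exp (\<i> * a * z) * sinh z * sinh z) / (cosh z * cosh z)) (at z within U - {p})"
      using nz[OF that] by (auto intro!: derivative_eq_intros simp: algebra_simps)
    also have "((exp (\<i> * a * z) * (\<i> * a) * sinh z + exp (\<i> * a * z) * cosh z) * cosh z - exp (\<i> * a * z) * sinh z * sinh z) / (cosh z * cosh z) = ?f z + \<i> * a * ?t z"
      unfolding eq hyperbolic_pythagoras using nz[OF that]
      by (simp add: add_divide_distrib power2_eq_square)
    finally show ?thesis .
  qed
  have zero: "((\<lambda>z. ?f z + \<i> * a * ?t z) has_contour_integral 0) ?r"
    by (rule Cauchy_theorem_primitive[OF der]) (use img in auto)
  have hyp: "(sinh :: complex \<Rightarrow> complex) holomorphic_on A" "(cosh :: complex \<Rightarrow> complex) holomorphic_on A" for A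
    unfolding sinh_field_def[abs_def] cosh_field_def[abs_def] by (auto intro!: holomorphic_intros)
  have holo: "?t holomorphic_on U - {p}"
    by (intro holomorphic_intros hyp) (use nz in auto)
  have res: "residue ?t p = exp (- pi * a / 2)"
  proof -
    have e: "exp p = \<i>" unfolding p_def by (simp only: cis_conv_exp[symmetric] cis_pi_half)
    then have c: "cosh p = 0" "sinh p = \<i>" by (simp_all add: cosh_field_def sinh_field_def exp_minus)
    have "residue ?t p = exp (\<i> * a * p) * sinh p / sinh p"
      by (rule residue_simple_pole_deriv[OF _ _ U pU]) (auto intro!: holomorphic_intros hyp derivative_eq_intros simp: c)
    also have "\<dots> = exp (\<i> * a * p)"
      by (rule nonzero_mult_div_cancel_right) (simp add: c)
    also have "\<dots> = exp (- pi * a / 2)" unfolding p_def exp_of_real[symmetric]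
      by (rule arg_cong[of _ _ exp]) (simp add: complex_eq_iff)
    finally show ?thesis .
  qed
  have wind: "winding_number ?r p = 1"
    by (rule winding_number_rectpath) (use R in \<open>auto simp: p_def in_box_complex_iff\<close>)
  have "contour_integral ?r ?t = 2 * pi * \<i> * (\<Sum>p\<in>{p}. winding_number ?r p * residue ?t p)"
  proof (rule Residue_theorem[OF U _ holo])
    show "\<forall>z. z \<notin> U \<longrightarrow> winding_number ?r z = 0"
    proof (intro allI impI winding_number_rectpath_outside)
      fix z assume "z \<notin> U"
      then show "z \<notin> cbox (- complex_of_real R) (Complex R pi)"
        using strip[of "Im z"] by (auto simp: U_def in_cbox_complex_iff)
    qed (use R in auto)
  qed (use img in auto)
  then have t: "contour_integral ?r ?t = 2 * pi * \<i> * exp (- pi * a / 2)"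
    by (simp add: wind res)
  have ti: "?t contour_integrable_on ?r"
    by (rule contour_integrable_holomorphic_simple[OF holo _ _ img]) (auto intro: open_delete U)
  have "((\<lambda>z. (?f z + \<i> * a * ?t z) - \<i> * a * ?t z) has_contour_integral
      (0 - \<i> * a * contour_integral ?r ?t)) ?r"
    by (intro has_contour_integral_diff zero has_contour_integral_lmul has_contour_integral_integral ti)
  then have "(?f has_contour_integral (0 - \<i> * a * contour_integral ?r ?t)) ?r" by simp
  then have "contour_integral ?r ?f = - \<i> * a * contour_integral ?r ?t"
    using contour_integral_unique by fastforce
  then show ?thesis unfolding t by (simp add: algebra_simps)
qed

lemma cosh_complex_of_real: "cosh (complex_of_real x) = of_real (cosh x)"
  by (simp add: cosh_field_def flip: exp_of_real of_real_minus)

text \<open>The continuous extension of \<open>z / sinh z\<close> to the origin.\<close>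
definition zcsch :: "real \<Rightarrow> real" where
  "zcsch z = (if z = 0 then 1 else z / sinh z)"

lemma contour_integral_linepath_translate:
  "contour_integral (linepath (a + c) (b + c)) f = contour_integral (linepath a b) (\<lambda>z. f (z + c))"
proof -
  have "linepath (a + c) (b + c) x = linepath a b x + c" for x :: real
    by (simp add: linepath_def algebra_simps)
  then show ?thesis
    by (simp add: contour_integral_integral)
qed

text \<open>Integrate over the rectangle with base \<open>[- R, R]\<close> and height \<open>\<pi>\<close>. As \<open>cosh\<^sup>2\<close> has period \<open>\<i> \<pi>\<close>, the
  top side is \<open>- exp (- \<pi> a)\<close> times the bottom side for \<open>a = 2 \<pi> y\<close>, and the vertical sides vanish as
  \<open>R\<close> grows. The case \<open>y = 0\<close> is separate because the factor \<open>1 - exp (- \<pi> a)\<close> vanishes there.\<close>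
lemma fourier_sech_sq:
  "(\<integral>x. cis (2 * pi * (x * y)) / (cosh x)\<^sup>2 \<partial>lborel) = of_real (2 * zcsch (pi\<^sup>2 * y))"
proof (cases "y = 0")
  case True
  have "(\<integral>x. complex_of_real (1 / (cosh x)\<^sup>2) \<partial>lborel) = of_real 2"
    unfolding integral_complex_of_real integral_sech_sq ..
  then show ?thesis using True by (simp add: zcsch_def)
next
  case False
  define a where "a = 2 * pi * y"
  have a: "a \<noteq> 0" using False by (simp add: a_def)
  let ?f = "\<lambda>z. exp (\<i> * a * z) / (cosh z)\<^sup>2"
  let ?g = "\<lambda>x::real. ?f (of_real x)"
  have g_eq: "?g x = cis (2 * pi * (x * y)) / (cosh x)\<^sup>2" for x
    by (simp add: a_def cis_conv_exp mult_ac cosh_complex_of_real)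
  have norm_g: "norm (?g x) = 1 / (cosh x)\<^sup>2" for x
    unfolding g_eq by (simp add: norm_divide norm_power)
  have contg: "continuous_on A ?g" for A
    by (auto intro!: continuous_intros simp: cosh_complex_of_real)
  have m: "?g \<in> borel_measurable borel" by (intro borel_measurable_continuous_onI contg)
  have gi: "integrable lborel ?g"
    by (rule Bochner_Integration.integrable_bound[OF integrable_sech_sq]) (use m norm_g in auto)
  define q where "q = exp (- pi * a)"
  define J where "J = (\<lambda>R::real. integral {-R..R} ?g)"
  define side where "side = (\<lambda>R::real. contour_integral (linepath (of_real R) (Complex R pi)) ?f
        + contour_integral (linepath (Complex (-R) pi) (- of_real R)) ?f)"
  have per: "?f (z + \<i> * pi) = q * ?f z" for z
  proof -
    have "cosh (z + \<i> * pi) = - cosh z"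
    proof -
      have "exp (z + \<i> * pi) = - exp z" by (simp add: exp_add mult.commute[of \<i>] exp_pi_i)
      moreover have "exp (- (z + \<i> * pi)) = - exp (- z)"
        by (simp add: exp_diff exp_minus mult.commute[of \<i>] exp_pi_i)
      ultimately show ?thesis unfolding cosh_field_def by (simp only:) (simp add: field_simps)
    qed
    moreover have "exp (\<i> * a * (z + \<i> * pi)) = q * exp (\<i> * a * z)"
      by (simp add: q_def exp_add[symmetric] algebra_simps flip: exp_of_real)
    ultimately show ?thesis by simp
  qed
  have rect: "(1 - q) * J R + side R = 2 * pi * a * exp (- pi * a / 2)" if R: "0 < R" for R
  proof -
    have co: "continuous_on (closed_segment u v) ?f"
      if "closed_segment u v \<subseteq> path_image (rectpath (- of_real R) (Complex R pi))" for u v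
    proof -
      have "cosh z \<noteq> 0" if z: "z \<in> path_image (rectpath (- of_real R) (Complex R pi))" for z
      proof
        assume 0: "cosh z = 0"
        have "0 \<le> Im z" "Im z \<le> pi" and side: "Re z \<in> {-R, R} \<or> Im z \<in> {0, pi}"
          using z R by (auto simp: path_image_rectpath)
        then have "- pi / 2 < Im z" "Im z < 3 * pi / 2" using pi_gt_zero by linarith+
        from cosh_eq_0_strip[OF this 0] have "Re z = 0" "Im z = pi / 2"
          by (simp_all only: Im_i_times Re_i_times Re_complex_of_real Im_complex_of_real)
        with side R pi_gt_zero show False by auto
      qed
      then show ?thesis using that by (auto intro!: continuous_intros)
    qed
    have R': "closed_segment (- of_real R) (of_real R) \<subseteq> path_image (rectpath (- of_real R) (Complex R pi))"
      "closed_segment (of_real R) (Complex R pi) \<subseteq> path_image (rectpath (- of_real R) (Complex R pi))"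
      "closed_segment (Complex R pi) (Complex (-R) pi) \<subseteq> path_image (rectpath (- of_real R) (Complex R pi))"
      "closed_segment (Complex (-R) pi) (- of_real R) \<subseteq> path_image (rectpath (- of_real R) (Complex R pi))"
      by (auto simp: rectpath_def Let_def path_image_join complex_of_real_def)
    note ci = R'[THEN co, THEN contour_integrable_continuous_linepath]
    have corner: "Complex (Re (Complex R pi)) (Im (- of_real R)) = of_real R"
      "Complex (Re (- of_real R)) (Im (Complex R pi)) = Complex (- R) pi"
      by (simp_all add: complex_eq_iff)
    have split: "contour_integral (rectpath (- of_real R) (Complex R pi)) ?f
       = contour_integral (linepath (- of_real R) (of_real R)) ?f
       + contour_integral (linepath (of_real R) (Complex R pi)) ?f
       + contour_integral (linepath (Complex R pi) (Complex (-R) pi)) ?f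
       + contour_integral (linepath (Complex (-R) pi) (- of_real R)) ?f"
      unfolding rectpath_def Let_def corner
      by (simp add: ci contour_integrable_joinI valid_path_join)
    have bottom: "contour_integral (linepath (- of_real R) (of_real R)) ?f = J R"
      unfolding J_def using R by (subst contour_integral_linepath_Reals_eq) auto
    have top: "contour_integral (linepath (Complex R pi) (Complex (-R) pi)) ?f = - (q * J R)"
    proof -
      have "contour_integral (linepath (Complex R pi) (Complex (-R) pi)) ?f
          = - contour_integral (linepath (- of_real R + \<i> * pi) (of_real R + \<i> * pi)) ?f"
      proof -
        have "Complex R pi = of_real R + \<i> * pi" "Complex (-R) pi = - of_real R + \<i> * pi"
          by (simp_all add: complex_eq_iff)
        then show ?thesis
          using contour_integral_reverse_linepath[OF co[OF R'(3)]] by metis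
      qed
      also have "\<dots> = - contour_integral (linepath (- of_real R) (of_real R)) (\<lambda>z. q * ?f z)"
        unfolding contour_integral_linepath_translate per ..
      also have "\<dots> = - (q * contour_integral (linepath (- of_real R) (of_real R)) ?f)"
        by (subst contour_integral_lmul) (use ci in auto)
      finally show ?thesis unfolding bottom .
    qed
    have arith: "(1 - c) * j + (s + t) = j + s + - (c * j) + t" for c j s t :: complex
      by (simp add: algebra_simps)
    have "(1 - q) * J R + side R = contour_integral (rectpath (- of_real R) (Complex R pi)) ?f"
      unfolding split bottom top side_def by (simp only: of_real_diff of_real_1 arith)
    then show ?thesis unfolding contour_integral_sech_sq_rect[OF R] .
  qed
  have side: "(side \<longlongrightarrow> 0) at_top"
  proof (rule Lim_null_comparison)
    have bnd: "norm (?f z) \<le> exp (\<bar>a\<bar> * pi) / (sinh R)\<^sup>2"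
      if R: "0 < R" and z: "Re z = R \<or> Re z = - R" "0 \<le> Im z" "Im z \<le> pi" for R z
    proof -
      have "sinh R \<le> norm (cosh z)"
        using norm_cosh_ge[of z] norm_cosh_ge[of "-z"] z(1) by auto
      moreover have "0 < sinh R" using R by simp
      ultimately have "(sinh R)\<^sup>2 \<le> (norm (cosh z))\<^sup>2" "0 < (sinh R)\<^sup>2"
        by (auto intro: power_mono)
      moreover have "norm (exp (\<i> * a * z)) \<le> exp (\<bar>a\<bar> * pi)"
      proof -
        have "- (a * Im z) \<le> \<bar>a\<bar> * \<bar>Im z\<bar>" by (metis abs_ge_minus_self abs_mult)
        also have "\<dots> \<le> \<bar>a\<bar> * pi" using z by (intro mult_left_mono) auto
        finally show ?thesis by simp
      qed
      ultimately show ?thesis unfolding norm_divide norm_power by (intro frac_le) auto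
    qed
    have seg: "norm (contour_integral (linepath u v) ?f) \<le> exp (\<bar>a\<bar> * pi) / (sinh R)\<^sup>2 * pi"
      if R: "0 < R" and uv: "{Re u, Re v} \<subseteq> {R} \<or> {Re u, Re v} \<subseteq> {-R}" "Im u = 0 \<and> Im v = pi \<or> Im u = pi \<and> Im v = 0" for u v R
    proof -
      have n: "norm (v - u) = pi"
        using uv by (auto simp: cmod_def)
      have zz: "Re z = R \<or> Re z = - R" "0 \<le> Im z" "Im z \<le> pi" if "z \<in> closed_segment u v" for z
        using that uv by (auto simp: closed_segment_same_Re closed_segment_eq_real_ivl split: if_splits)
      have "cosh z \<noteq> 0" if "z \<in> closed_segment u v" for z
        using zz[OF that] R norm_cosh_ge[of z] norm_cosh_ge[of "-z"] by auto
      then have "?f contour_integrable_on linepath u v"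
        by (intro contour_integrable_continuous_linepath continuous_intros) auto
      then have "norm (contour_integral (linepath u v) ?f) \<le> exp (\<bar>a\<bar> * pi) / (sinh R)\<^sup>2 * norm (v - u)"
        by (rule contour_integral_bound_linepath) (use bnd[OF R] zz in auto)
      then show ?thesis by (simp add: n)
    qed
    show "\<forall>\<^sub>F R in at_top. norm (side R) \<le> 2 * (exp (\<bar>a\<bar> * pi) / (sinh R)\<^sup>2 * pi)"
    proof (rule eventually_mono[OF eventually_gt_at_top[of 0]])
      fix R :: real assume R: "0 < R"
      show "norm (side R) \<le> 2 * (exp (\<bar>a\<bar> * pi) / (sinh R)\<^sup>2 * pi)"
        unfolding side_def mult_2
        by (rule order_trans[OF norm_triangle_ineq add_mono]; rule seg[OF R]; simp)
    qed
    show "((\<lambda>R. 2 * (exp (\<bar>a\<bar> * pi) / (sinh R)\<^sup>2 * pi)) \<longlongrightarrow> 0) at_top"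
      unfolding sinh_field_def by real_asymp
  qed
  have J: "(J \<longlongrightarrow> integral\<^sup>L lborel ?g) at_top"
  proof -
    have "((\<lambda>R. \<integral>x. indicator {-R..R} x *\<^sub>R ?g x \<partial>lborel) \<longlongrightarrow> integral\<^sup>L lborel ?g) at_top"
    proof (rule integral_dominated_convergence_at_top[where w = "\<lambda>x. norm (?g x)"])
      show "AE x in lborel. ((\<lambda>R. indicator {-R..R} x *\<^sub>R ?g x) \<longlongrightarrow> ?g x) at_top"
      proof (intro AE_I2 tendsto_eventually)
        fix x :: real
        show "\<forall>\<^sub>F R in at_top. indicator {-R..R} x *\<^sub>R ?g x = ?g x"
          by (rule eventually_mono[OF eventually_ge_at_top[of "\<bar>x\<bar>"]]) (auto simp: indicator_def)
      qed
    qed (use m gi in \<open>auto simp: indicator_def\<close>)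
    moreover have "(\<integral>x. indicator {-R..R} x *\<^sub>R ?g x \<partial>lborel) = J R" for R
      unfolding J_def set_lebesgue_integral_def[symmetric]
      by (rule set_borel_integral_eq_integral(2)) (simp add: set_integrable_def integrable_mult_indicator gi)
    ultimately show ?thesis by simp
  qed
  have lim1: "((\<lambda>R. (1 - q) * J R + side R) \<longlongrightarrow> (1 - q) * integral\<^sup>L lborel ?g + 0) at_top"
    by (intro tendsto_intros J side)
  have lim2: "((\<lambda>R. (1 - q) * J R + side R) \<longlongrightarrow> of_real (2 * pi * a * exp (- pi * a / 2))) at_top"
    by (rule tendsto_eventually, rule eventually_mono[OF eventually_gt_at_top[of 0]]) (rule rect)
  have q1: "1 - q \<noteq> 0" using a by (simp add: q_def)
  have "2 * pi * a * exp (- pi * a / 2) = (1 - q) * (2 * zcsch (pi\<^sup>2 * y))"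
  proof -
    have "1 - q = 2 * exp (- pi * a / 2) * sinh (pi * a / 2)"
    proof -
      have "exp (- (pi * a / 2)) * exp (pi * a / 2) = 1"
        and "exp (- (pi * a / 2)) * exp (- (pi * a / 2)) = q"
        by (simp_all add: q_def flip: exp_add)
      then show ?thesis by (simp add: sinh_field_def right_diff_distrib)
    qed
    moreover have arg: "pi\<^sup>2 * y = pi * a / 2" by (simp add: a_def power2_eq_square)
    have "zcsch (pi\<^sup>2 * y) = (pi * a / 2) / sinh (pi * a / 2)"
      unfolding arg using a by (simp add: zcsch_def)
    moreover have "sinh (pi * a / 2) \<noteq> 0" using a by simp
    ultimately show ?thesis by simp
  qed
  then have "of_real (1 - q) * integral\<^sup>L lborel ?g = of_real (1 - q) * of_real (2 * zcsch (pi\<^sup>2 * y))"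
    using tendsto_unique[OF trivial_limit_at_top_linorder lim1 lim2] by (simp only: add_0_right of_real_mult)
  then have "integral\<^sup>L lborel ?g = of_real (2 * zcsch (pi\<^sup>2 * y))"
    using q1 by (simp only: mult_cancel_left of_real_eq_0_iff simp_thms)
  then show ?thesis unfolding g_eq .
qed

section \<open>Fejer kernels\<close>

definition fejer :: "nat \<Rightarrow> real \<Rightarrow> real" where
  "fejer N t = (norm (\<Sum>j<N. cis (2 * pi * (real j * t))))\<^sup>2 / real N"

lemma fejer_nonneg: "0 \<le> fejer N t"
  by (simp add: fejer_def)

lemma sum_symmetric_int_interval:
  fixes c :: "int \<Rightarrow> 'a::comm_monoid_add"
  shows "(\<Sum>k\<in>{- int N..int N}. c k) = c 0 + (\<Sum>j<N. c (int j - int N)) + (\<Sum>j<N. c (int N - int j))"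
proof -
  have split: "{- int N..int N} = insert 0 ((\<lambda>j. int j - int N) ` {..<N} \<union> (\<lambda>j. int N - int j) ` {..<N})"
  proof (intro equalityI subsetI)
    fix k assume k: "k \<in> {- int N..int N}"
    consider "k = 0" | "k < 0" | "k > 0" by linarith
    then show "k \<in> insert 0 ((\<lambda>j. int j - int N) ` {..<N} \<union> (\<lambda>j. int N - int j) ` {..<N})"
    proof cases
      case 2
      then have "k = int (nat (k + int N)) - int N" "nat (k + int N) < N" using k by auto
      then show ?thesis by blast
    next
      case 3
      then have "k = int N - int (nat (int N - k))" "nat (int N - k) < N" using k by auto
      then show ?thesis by blast
    qed simp
  qed auto
  have "(\<Sum>k\<in>{- int N..int N}. c k)
      = c 0 + ((\<Sum>k\<in>(\<lambda>j. int j - int N) ` {..<N}. c k) + (\<Sum>k\<in>(\<lambda>j. int N - int j) ` {..<N}. c k))"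
    unfolding split by (subst sum.insert; (subst sum.union_disjoint)?) auto
  also have "(\<Sum>k\<in>(\<lambda>j. int j - int N) ` {..<N}. c k) = (\<Sum>j<N. c (int j - int N))"
    by (subst sum.reindex) (auto simp: inj_on_def)
  also have "(\<Sum>k\<in>(\<lambda>j. int N - int j) ` {..<N}. c k) = (\<Sum>j<N. c (int N - int j))"
    by (subst sum.reindex) (auto simp: inj_on_def)
  finally show ?thesis by (simp add: add.assoc)
qed

text \<open>Adding the next summand \<open>u\<close> to \<open>d\<close> changes the square of the modulus by
  \<open>1 + d * cnj u + cnj d * u\<close>, which is the sum of all exponentials with frequency between \<open>- N\<close> and
  \<open>N\<close>; every frequency in that range thus gains one.\<close>
lemma dirichlet_square:
  "complex_of_real ((norm (\<Sum>j<N. cis (2 * pi * (real j * t))))\<^sup>2)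
    = (\<Sum>k\<in>{- int N..int N}. of_real (real N - \<bar>of_int k\<bar>) * cis (2 * pi * (of_int k * t)))"
proof (induction N)
  case (Suc N)
  let ?e = "\<lambda>k::int. cis (2 * pi * (of_int k * t))"
  define d where "d = (\<Sum>j<N. cis (2 * pi * (real j * t)))"
  define u where "u = cis (2 * pi * (real N * t))"
  have u: "u * cnj u = 1" by (simp add: u_def cis_cnj cis_mult)
  have du: "d * cnj u = (\<Sum>j<N. ?e (int j - int N))"
    unfolding d_def u_def sum_distrib_right
    by (intro sum.cong refl) (simp add: cis_cnj cis_mult algebra_simps)
  have ud: "cnj d * u = (\<Sum>j<N. ?e (int N - int j))"
    unfolding d_def u_def cnj_sum sum_distrib_right
    by (intro sum.cong refl) (simp add: cis_cnj cis_mult algebra_simps)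
  have "complex_of_real ((norm (d + u))\<^sup>2) = d * cnj d + u * cnj u + d * cnj u + cnj d * u"
    unfolding complex_norm_square by (simp add: algebra_simps)
  also have "\<dots> = complex_of_real ((norm d)\<^sup>2) + (\<Sum>k\<in>{- int N..int N}. ?e k)"
    unfolding sum_symmetric_int_interval[of ?e] u du ud complex_norm_square by simp
  also have "complex_of_real ((norm d)\<^sup>2)
      = (\<Sum>k\<in>{- int N..int N}. of_real (real N - \<bar>of_int k\<bar>) * ?e k)"
    using Suc by (simp add: d_def)
  also have "\<dots> + (\<Sum>k\<in>{- int N..int N}. ?e k)
      = (\<Sum>k\<in>{- int N..int N}. of_real (real (Suc N) - \<bar>of_int k\<bar>) * ?e k)"
    unfolding sum.distrib[symmetric] by (intro sum.cong refl) (simp add: algebra_simps)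
  also have "\<dots> = (\<Sum>k\<in>{- int (Suc N)..int (Suc N)}. of_real (real (Suc N) - \<bar>of_int k\<bar>) * ?e k)"
  proof (rule sum.mono_neutral_left)
    show "\<forall>k\<in>{- int (Suc N)..int (Suc N)} - {- int N..int N}. of_real (real (Suc N) - \<bar>of_int k\<bar>) * ?e k = 0"
    proof
      fix k assume "k \<in> {- int (Suc N)..int (Suc N)} - {- int N..int N}"
      then have "k = int (Suc N) \<or> k = - int (Suc N)" by auto
      then show "of_real (real (Suc N) - \<bar>of_int k\<bar>) * ?e k = 0" by auto
    qed
  qed auto
  finally show ?case by (simp add: d_def u_def)
qed simp

definition fejer_coeff :: "nat \<Rightarrow> int \<Rightarrow> real" where
  "fejer_coeff N k = 1 - \<bar>of_int k\<bar> / real N"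

lemma fejer_expand_complex:
  assumes "N > 0"
  shows "complex_of_real (fejer N t) = (\<Sum>k\<in>{- int N..int N}. of_real (fejer_coeff N k) * cis (2 * pi * (of_int k * t)))"
proof -
  have "complex_of_real (fejer N t) = complex_of_real ((norm (\<Sum>j<N. cis (2 * pi * (real j * t))))\<^sup>2) / of_nat N"
    by (simp add: fejer_def)
  also have "\<dots> = (\<Sum>k\<in>{- int N..int N}. of_real (real N - \<bar>of_int k\<bar>) / of_nat N * cis (2 * pi * (of_int k * t)))"
    unfolding dirichlet_square by (simp add: sum_divide_distrib)
  also have "\<dots> = (\<Sum>k\<in>{- int N..int N}. of_real (fejer_coeff N k) * cis (2 * pi * (of_int k * t)))"
    using assms by (intro sum.cong refl) (simp add: fejer_coeff_def diff_divide_distrib)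
  finally show ?thesis .
qed

lemma fejer_expand:
  assumes "N > 0"
  shows "fejer N t = (\<Sum>k\<in>{- int N..int N}. fejer_coeff N k * cos (2 * pi * (of_int k * t)))"
  using arg_cong[OF fejer_expand_complex[OF assms], of Re] by simp

lemma continuous_fejer [continuous_intros]:
  "continuous_on A f \<Longrightarrow> continuous_on A (\<lambda>x. fejer N (f x))"
  unfolding fejer_def by (cases "N = 0") (auto intro!: continuous_intros)

lemma fejer_measurable [measurable]: "fejer N \<in> borel_measurable borel"
  by (intro borel_measurable_continuous_onI continuous_intros)

lemma integral_fejer:
  assumes "N > 0"
  shows "has_bochner_integral lborel (\<lambda>t. indicator {-1/2..<1/2} t * fejer N t) 1"
proof -
  let ?I = "{-1/2..1/2::real}"
  have cos: "has_bochner_integral lborel (\<lambda>t. indicator ?I t * cos (2 * pi * (of_int k * t))) (if k = 0 then 1 else 0)" for k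
  proof (cases "k = 0")
    case True
    have "has_bochner_integral lborel (indicator ?I) (measure lborel ?I)"
      by (rule has_bochner_integral_real_indicator) auto
    then show ?thesis using True by simp
  next
    case False
    let ?F = "\<lambda>t. sin (2 * pi * (of_int k * t)) / (2 * pi * of_int k)"
    have "has_bochner_integral lborel (\<lambda>t. cos (2 * pi * (of_int k * t)) * indicator ?I t) (?F (1/2) - ?F (-1/2))"
      by (rule has_bochner_integral_FTC_Icc_real)
         (use False in \<open>auto intro!: derivative_eq_intros continuous_intros\<close>)
    then show ?thesis using False by (simp add: mult.commute)
  qed
  have "has_bochner_integral lborel (\<lambda>t. \<Sum>k\<in>{- int N..int N}. fejer_coeff N k * (indicator ?I t * cos (2 * pi * (of_int k * t))))
     (\<Sum>k\<in>{- int N..int N}. fejer_coeff N k * (if k = 0 then 1 else 0))"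
    by (intro has_bochner_integral_sum has_bochner_integral_mult_right cos)
  also have "(\<lambda>t. \<Sum>k\<in>{- int N..int N}. fejer_coeff N k * (indicator ?I t * cos (2 * pi * (of_int k * t)))) = (\<lambda>t. indicator ?I t * fejer N t)"
    by (auto simp: fejer_expand[OF assms] sum_distrib_left mult_ac)
  also have "(\<Sum>k\<in>{- int N..int N}. fejer_coeff N k * (if k = 0 then 1 else 0)) = 1"
    by (simp add: fejer_coeff_def if_distrib[of "(*) _"] cong: if_cong)
  finally have "has_bochner_integral lborel (\<lambda>t. indicator ?I t * fejer N t) 1" .
  moreover have "AE t in lborel. indicator ?I t * fejer N t = indicator {-1/2..<1/2} t * fejer N t"
    using AE_lborel_singleton[of "1/2::real"] by eventually_elim (auto simp: indicator_def)
  ultimately show ?thesis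
    by (subst (asm) has_bochner_integral_cong_AE) (auto intro!: measurable)
qed

text \<open>A crude linear lower bound, valid up to \<open>2\<close> and hence on \<open>[- \<pi> / 2, \<pi> / 2]\<close>.\<close>
lemma abs_sin_ge_third: "\<bar>x\<bar> / 3 \<le> \<bar>sin x\<bar>" if "\<bar>x\<bar> \<le> 2" for x :: real
proof -
  have "\<bar>sin x - (\<Sum>m<3. sin_coeff m * x ^ m)\<bar> \<le> inverse (fact 3) * \<bar>x\<bar> ^ 3"
    by (rule Maclaurin_sin_bound)
  then have "\<bar>sin x - x\<bar> \<le> \<bar>x\<bar> ^ 3 / 6"
    by (simp add: sin_coeff_def eval_nat_numeral lessThan_Suc)
  moreover have "\<bar>x\<bar> ^ 3 = \<bar>x\<bar> * \<bar>x\<bar>\<^sup>2" by (simp add: power2_eq_square power3_eq_cube)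
  moreover have "\<bar>x\<bar> * \<bar>x\<bar>\<^sup>2 \<le> \<bar>x\<bar> * 2\<^sup>2"
    using that by (intro mult_left_mono power_mono) auto
  ultimately have "\<bar>sin x - x\<bar> \<le> 4 * \<bar>x\<bar> / 6" by simp
  then show ?thesis by linarith
qed

lemma norm_one_minus_cis: "norm (1 - cis (2 * x)) = 2 * \<bar>sin x\<bar>"
proof -
  have "(norm (1 - cis (2 * x)))\<^sup>2 = (2 * (sin x)\<^sup>2)\<^sup>2 + (2 * sin x * cos x)\<^sup>2"
    by (simp add: cmod_power2 cos_double_sin sin_double)
  also have "\<dots> = 4 * (sin x)\<^sup>2 * ((sin x)\<^sup>2 + (cos x)\<^sup>2)"
    by algebra
  also have "\<dots> = (2 * \<bar>sin x\<bar>)\<^sup>2" by (simp add: power_mult_distrib)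
  finally show ?thesis by (rule power2_eq_imp_eq) auto
qed

text \<open>The Dirichlet sum is geometric with ratio \<open>cis (2 \<pi> t)\<close>, and the distance of that ratio from \<open>1\<close> is
  at least \<open>2 \<bar>t\<bar>\<close>.\<close>
lemma square_times_fejer_le:
  assumes t: "\<bar>t\<bar> \<le> 1/2"
  shows "t\<^sup>2 * fejer N t \<le> 1 / real N"
proof -
  define d where "d = (\<Sum>j<N. cis (2 * pi * (real j * t)))"
  define z where "z = cis (2 * pi * t)"
  have "d = (\<Sum>j<N. z ^ j)" unfolding d_def by (intro sum.cong refl) (simp add: z_def Complex.DeMoivre mult_ac)
  then have "(1 - z) * d = 1 - z ^ N" by (simp add: one_diff_power_eq)
  moreover have "norm (1 - z ^ N) \<le> 2"
    using norm_triangle_ineq4[of 1 "z ^ N"] by (simp add: norm_power z_def)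
  ultimately have "norm (1 - z) * norm d \<le> 2" by (metis norm_mult)
  moreover have "2 * \<bar>t\<bar> \<le> norm (1 - z)"
  proof -
    have pt: "\<bar>pi * t\<bar> = pi * \<bar>t\<bar>" by (simp add: abs_mult)
    have "pi * \<bar>t\<bar> \<le> 4 * (1/2)" using t pi_less_4 by (intro mult_mono) auto
    moreover have "3 * \<bar>t\<bar> \<le> pi * \<bar>t\<bar>" using pi_gt3 by (intro mult_right_mono) auto
    ultimately have "\<bar>t\<bar> \<le> \<bar>sin (pi * t)\<bar>" using abs_sin_ge_third[of "pi * t"] pt by linarith
    then show ?thesis using norm_one_minus_cis[of "pi * t"] by (simp add: z_def mult.assoc)
  qed
  ultimately have "2 * \<bar>t\<bar> * norm d \<le> 2"
    using mult_right_mono[of "2 * \<bar>t\<bar>" "norm (1 - z)" "norm d"] by simp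
  then have "(\<bar>t\<bar> * norm d)\<^sup>2 \<le> 1\<^sup>2" by (intro power_mono) auto
  then show ?thesis
    by (simp add: fejer_def d_def power_mult_distrib divide_right_mono)
qed

definition fejer_vec :: "nat \<Rightarrow> real ^ 'n \<Rightarrow> real" where
  "fejer_vec N w = (\<Prod>i\<in>UNIV. fejer N (w $ i))"

definition int_box :: "nat \<Rightarrow> ('n \<Rightarrow> int) set" where
  "int_box N = PiE UNIV (\<lambda>_. {- int N..int N})"

definition fejer_weight :: "nat \<Rightarrow> ('n::finite \<Rightarrow> int) \<Rightarrow> real" where
  "fejer_weight N k = (\<Prod>i\<in>UNIV. fejer_coeff N (k i))"

lemma finite_int_box: "finite (int_box N :: ('n::finite \<Rightarrow> int) set)"
  unfolding int_box_def by (intro finite_PiE) auto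

lemma in_int_box: "k \<in> int_box N \<longleftrightarrow> (\<forall>i. \<bar>k i\<bar> \<le> int N)"
proof -
  have "k i \<in> {- int N..int N} \<longleftrightarrow> \<bar>k i\<bar> \<le> int N" for i by auto
  then show ?thesis by (simp add: int_box_def PiE_iff)
qed

lemma fejer_weight_bounds:
  assumes "k \<in> int_box N"
  shows "0 \<le> fejer_weight N k" "fejer_weight N k \<le> 1"
proof -
  have "0 \<le> fejer_coeff N (k i) \<and> fejer_coeff N (k i) \<le> 1" for i
  proof -
    have "\<bar>k i\<bar> \<le> int N" using assms by (simp add: in_int_box)
    then have "real_of_int \<bar>k i\<bar> \<le> real N" by linarith
    then show ?thesis by (cases "N = 0") (auto simp: fejer_coeff_def)
  qed
  then show "0 \<le> fejer_weight N k" "fejer_weight N k \<le> 1"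
    unfolding fejer_weight_def by (auto intro: prod_nonneg prod_le_1)
qed

lemma fejer_weight_0 [simp]: "fejer_weight N (\<lambda>_. 0) = 1"
  by (simp add: fejer_weight_def fejer_coeff_def)

lemma fejer_weight_tendsto:
  fixes k :: "'n::finite \<Rightarrow> int"
  shows "(\<lambda>N. fejer_weight N k) \<longlonglongrightarrow> 1"
proof -
  have coeff: "(\<lambda>N. fejer_coeff N j) \<longlonglongrightarrow> 1 - 0" for j
    unfolding fejer_coeff_def by (intro tendsto_intros lim_const_over_n)
  have "(\<lambda>N. fejer_weight N k) \<longlonglongrightarrow> (\<Prod>i\<in>(UNIV :: 'n set). 1 - 0)"
    unfolding fejer_weight_def by (intro tendsto_prod coeff)
  then show ?thesis by simp
qed

lemma fejer_vec_nonneg: "0 \<le> fejer_vec N w"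
  by (simp add: fejer_vec_def fejer_nonneg prod_nonneg)

lemma fejer_vec_measurable [measurable]: "fejer_vec N \<in> borel_measurable borel"
  unfolding fejer_vec_def[abs_def] by measurable

lemma cis_sum: "finite A \<Longrightarrow> cis (\<Sum>i\<in>A. f i) = (\<Prod>i\<in>A. cis (f i))"
  by (induction A rule: finite_induct) (simp_all flip: cis_mult)

text \<open>Multiplying out the one-dimensional expansions gives a finite trigonometric sum over integer vectors;
  its coefficients lie in \<open>[0, 1]\<close>, the one at the origin is \<open>1\<close>, and each tends to \<open>1\<close> as \<open>N\<close>
  grows. This is what makes the Fejer means approach the Poisson series.\<close>
lemma fejer_vec_expand:
  assumes "N > 0"
  shows "fejer_vec N w = (\<Sum>k\<in>int_box N. fejer_weight N k * cos (2 * pi * (w \<bullet> ivec k)))"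
proof -
  have "complex_of_real (fejer_vec N w)
      = (\<Prod>i\<in>UNIV. \<Sum>k\<in>{- int N..int N}. of_real (fejer_coeff N k) * cis (2 * pi * (of_int k * w $ i)))"
    by (simp add: fejer_vec_def fejer_expand_complex[OF assms])
  also have "\<dots> = (\<Sum>k\<in>int_box N. \<Prod>i\<in>UNIV. of_real (fejer_coeff N (k i)) * cis (2 * pi * (of_int (k i) * w $ i)))"
    unfolding int_box_def by (rule prod_sum_PiE) auto
  also have "\<dots> = (\<Sum>k\<in>int_box N. of_real (fejer_weight N k) * cis (2 * pi * (w \<bullet> ivec k)))"
    by (intro sum.cong refl)
       (simp add: prod.distrib fejer_weight_def inner_vec_def sum_distrib_left cis_sum mult_ac)
  finally show ?thesis by (auto dest: arg_cong[of _ _ Re])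
qed

lemma fejer_vec_periodic: "fejer_vec N (w + ivec k) = fejer_vec N w"
proof -
  have "cis (2 * pi * (real j * (t + of_int m))) = cis (2 * pi * (real j * t))" for j :: nat and m :: int and t :: real
  proof -
    have "cis (2 * pi * (real j * (t + of_int m))) = cis (2 * pi * (real j * t)) * cis (2 * pi * of_int (int j * m))"
      by (simp add: cis_mult algebra_simps)
    also have "cis (2 * pi * of_int (int j * m)) = 1"
      by (rule cis_multiple_2pi) auto
    finally show ?thesis by simp
  qed
  then have "fejer N (t + of_int m) = fejer N t" for t m by (simp add: fejer_def)
  then show ?thesis by (simp add: fejer_vec_def)
qed

lemma indicator_cube: "indicator cube w = (\<Prod>i\<in>UNIV. indicator {-1/2..<1/2} (w $ i) :: real)"
  by (auto simp: indicator_def cube_def)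

lemma integral_fejer_vec:
  assumes "N > 0"
  shows "has_bochner_integral lborel (\<lambda>w :: real^'n. indicator cube w * fejer_vec N w) 1"
proof -
  let ?\<phi> = "\<lambda>(_::'n) t. indicator {-1/2..<1/2} t * fejer N t :: real"
  have i: "integrable lborel (?\<phi> i)" "integral\<^sup>L lborel (?\<phi> i) = 1" for i
    using integral_fejer[OF assms] by (simp_all add: has_bochner_integral_iff)
  have eq: "(\<lambda>w :: real^'n. \<Prod>i\<in>UNIV. ?\<phi> i (w $ i)) = (\<lambda>w. indicator cube w * fejer_vec N w)"
    by (simp add: indicator_cube fejer_vec_def prod.distrib)
  from integrable_prod_vec[of ?\<phi>] integral_prod_vec[of ?\<phi>] show ?thesis
    unfolding eq using i by (simp add: has_bochner_integral_iff)
qed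

text \<open>This quantifies the concentration of the kernel at the origin.\<close>
lemma second_moment_fejer_vec:
  assumes "N > 0"
  shows "integrable lborel (\<lambda>w :: real^'n. indicator cube w * (w $ j)\<^sup>2 * fejer_vec N w)"
    and "(\<integral>w. indicator cube w * (w $ j)\<^sup>2 * fejer_vec N w \<partial>(lborel :: (real^'n) measure)) \<le> 1 / real N"
proof -
  let ?\<psi> = "\<lambda>t. indicator {-1/2..<1/2} t * fejer N t :: real"
  let ?\<phi> = "\<lambda>(i::'n) t. (if i = j then t\<^sup>2 else 1) * ?\<psi> t"
  have \<psi>: "integrable lborel ?\<psi>" "integral\<^sup>L lborel ?\<psi> = 1"
    using integral_fejer[OF assms] by (simp_all add: has_bochner_integral_iff)
  have b: "t\<^sup>2 * ?\<psi> t \<le> 1 / real N * indicator {-1/2..<1/2} t" for t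
    using square_times_fejer_le[of t N] by (auto simp: indicator_def)
  have I: "integrable lborel (\<lambda>t. 1 / real N * indicator {-1/2..<1/2::real} t)"
    by (intro integrable_mult_right integrable_real_indicator) auto
  have sq: "integrable lborel (\<lambda>t. t\<^sup>2 * ?\<psi> t)"
    by (rule Bochner_Integration.integrable_bound[OF I])
       (use b in \<open>auto simp: abs_mult fejer_nonneg\<close>)
  have i: "integrable lborel (?\<phi> i)" for i
    using sq \<psi> by (cases "i = j") auto
  have eq: "(\<lambda>w :: real^'n. \<Prod>i\<in>UNIV. ?\<phi> i (w $ i)) = (\<lambda>w. indicator cube w * (w $ j)\<^sup>2 * fejer_vec N w)"
    by (simp add: indicator_cube fejer_vec_def prod.distrib mult_ac prod.delta')
  show "integrable lborel (\<lambda>w :: real^'n. indicator cube w * (w $ j)\<^sup>2 * fejer_vec N w)"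
    using integrable_prod_vec[of ?\<phi>, OF i] unfolding eq .
  have "(\<integral>w. indicator cube w * (w $ j)\<^sup>2 * fejer_vec N w \<partial>(lborel :: (real^'n) measure)) = (\<Prod>i\<in>UNIV. integral\<^sup>L lborel (?\<phi> i))"
    using integral_prod_vec[of ?\<phi>, OF i] unfolding eq .
  also have "\<dots> = (\<Prod>i\<in>UNIV. if i = j then (\<integral>t. t\<^sup>2 * ?\<psi> t \<partial>lborel) else 1)"
  proof (intro prod.cong refl)
    fix i
    show "integral\<^sup>L lborel (?\<phi> i) = (if i = j then (\<integral>t. t\<^sup>2 * ?\<psi> t \<partial>lborel) else 1)"
      by (cases "i = j") (simp_all only: if_True if_False mult_1 \<psi>(2) simp_thms)
  qed
  also have "\<dots> = (\<integral>t. t\<^sup>2 * ?\<psi> t \<partial>lborel)" by (simp add: prod.delta')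
  also have "\<dots> \<le> (\<integral>t. 1 / real N * indicator {-1/2..<1/2::real} t \<partial>lborel)"
    by (rule integral_mono[OF sq I]) (rule b)
  also have "\<dots> = 1 / real N" by simp
  finally show "(\<integral>w. indicator cube w * (w $ j)\<^sup>2 * fejer_vec N w \<partial>(lborel :: (real^'n) measure)) \<le> 1 / real N" .
qed

text \<open>The kernel is a probability density on the cube with second moments at most \<open>1 / N\<close>, so averages of a
  function that is Lipschitz at the origin converge to its value there, at rate \<open>1 / sqrt N\<close>.\<close>
lemma fejer_mean_tendsto:
  fixes F :: "real ^ 'n \<Rightarrow> real"
  assumes [measurable]: "F \<in> borel_measurable borel"
    and lip: "\<And>w. w \<in> cube \<Longrightarrow> \<bar>F w - F 0\<bar> \<le> C * l1_norm w"
  shows "(\<lambda>N. \<integral>w. indicator cube w * F w * fejer_vec N w \<partial>lborel) \<longlonglongrightarrow> F 0"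
proof (rule Lim_null_comparison[THEN LIM_zero_cancel])
  let ?K = "\<lambda>N w. indicator cube w * fejer_vec N w :: real"
  let ?Q = "\<lambda>N j (w::real^'n). indicator cube w * (w $ j)\<^sup>2 * fejer_vec N w :: real"
  let ?n = "real CARD('n)"
  define c where "c = \<bar>C\<bar>"
  show "(\<lambda>N. 2 * c * ?n / sqrt (real N)) \<longlonglongrightarrow> 0"
    by real_asymp
  show "\<forall>\<^sub>F N in sequentially. norm ((\<integral>w. indicator cube w * F w * fejer_vec N w \<partial>lborel) - F 0) \<le> 2 * c * ?n / sqrt (real N)"
  proof (rule eventually_sequentiallyI[of 1])
    fix N :: nat assume "1 \<le> N"
    then have N: "N > 0" by simp
    define s where "s = sqrt (real N)"
    have s: "s > 0" "s * s = real N" using N by (auto simp: s_def)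
    have K: "integrable lborel (?K N :: real^'n \<Rightarrow> real)" "integral\<^sup>L lborel (?K N :: real^'n \<Rightarrow> real) = 1"
      using integral_fejer_vec[OF N, where 'n = 'n] by (auto simp: has_bochner_integral_iff)
    note Q = second_moment_fejer_vec[OF N, where 'n = 'n]
    \<comment> \<open>By the arithmetic-geometric mean inequality \<open>2 s \<bar>x\<bar> \<le> 1 + s\<^sup>2 x\<^sup>2\<close>, the \<open>l1\<close> norm is controlled by
      second moments; \<open>s = sqrt N\<close> balances the two resulting terms.\<close>
    let ?B = "\<lambda>w::real^'n. \<Sum>j\<in>UNIV. c * (1 / s * ?K N w + s * ?Q N j w)"
    have Bi: "integrable lborel ?B"
      by (intro Bochner_Integration.integrable_sum integrable_mult_right Bochner_Integration.integrable_add K Q)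
    have pw: "\<bar>indicator cube w * (F w - F 0) * fejer_vec N w\<bar> \<le> ?B w" for w
    proof (cases "w \<in> cube")
      case True
      have am: "\<bar>x\<bar> \<le> 1 / s + s * x\<^sup>2" for x
      proof -
        have "0 \<le> (s * \<bar>x\<bar> - 1)\<^sup>2" by simp
        then have "2 * (s * \<bar>x\<bar>) \<le> 1 + (s * \<bar>x\<bar>)\<^sup>2" by (simp add: power2_diff power_mult_distrib)
        moreover have "0 \<le> s * \<bar>x\<bar>" using s by simp
        ultimately have "s * \<bar>x\<bar> \<le> 1 + (s * \<bar>x\<bar>)\<^sup>2" by linarith
        then show ?thesis using s(1) by (simp add: field_simps power2_eq_square)
      qed
      have "\<bar>F w - F 0\<bar> \<le> c * l1_norm w"
        using lip[OF True] mult_right_mono[OF abs_ge_self[of C] l1_norm_nonneg[of w]] by (simp add: c_def)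
      also have "\<dots> \<le> c * (\<Sum>j\<in>UNIV. 1 / s + s * (w $ j)\<^sup>2)"
        unfolding l1_norm_def by (intro mult_left_mono sum_mono am) (simp add: c_def)
      finally have "\<bar>F w - F 0\<bar> * fejer_vec N w \<le> c * (\<Sum>j\<in>UNIV. 1 / s + s * (w $ j)\<^sup>2) * fejer_vec N w"
        by (rule mult_right_mono) (rule fejer_vec_nonneg)
      also have "\<dots> = ?B w" using True by (simp add: sum_distrib_left sum_distrib_right algebra_simps)
      finally show ?thesis using True by (simp add: abs_mult fejer_vec_nonneg)
    qed simp
    have di: "integrable lborel (\<lambda>w. indicator cube w * (F w - F 0) * fejer_vec N w)"
      by (rule Bochner_Integration.integrable_bound[OF Bi])
         (use pw in \<open>auto intro: order_trans[OF _ abs_ge_self]\<close>)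
    have "(\<integral>w. indicator cube w * F w * fejer_vec N w \<partial>lborel)
        = (\<integral>w. indicator cube w * (F w - F 0) * fejer_vec N w + F 0 * ?K N w \<partial>lborel)"
      by (rule arg_cong[where f = "integral\<^sup>L lborel"]) (auto simp: algebra_simps)
    also have "\<dots> = (\<integral>w. indicator cube w * (F w - F 0) * fejer_vec N w \<partial>lborel) + F 0"
      using di K by (subst Bochner_Integration.integral_add) auto
    finally have "norm ((\<integral>w. indicator cube w * F w * fejer_vec N w \<partial>lborel) - F 0)
        = \<bar>\<integral>w. indicator cube w * (F w - F 0) * fejer_vec N w \<partial>lborel\<bar>" by simp
    also have "\<dots> \<le> (\<integral>w. \<bar>indicator cube w * (F w - F 0) * fejer_vec N w\<bar> \<partial>lborel)"
      by (rule integral_abs_bound)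
    also have "\<dots> \<le> integral\<^sup>L lborel ?B"
      by (rule integral_mono[OF integrable_abs[OF di] Bi pw])
    also have "\<dots> = (\<Sum>j\<in>(UNIV::'n set). c * (1 / s + s * integral\<^sup>L lborel (?Q N j)))"
      by (subst Bochner_Integration.integral_sum) (auto simp: K Q)
    also have "\<dots> \<le> (\<Sum>j\<in>(UNIV::'n set). c * (1 / s + s * (1 / real N)))"
      using s by (intro sum_mono mult_left_mono add_left_mono Q) (auto simp: c_def)
    also have "\<dots> = 2 * c * ?n / s"
      using s by (simp add: s(2)[symmetric])
    finally show "norm ((\<integral>w. indicator cube w * F w * fejer_vec N w \<partial>lborel) - F 0) \<le> 2 * c * ?n / sqrt (real N)"
      by (simp add: s_def)
  qed
qed

section \<open>Sums over integer vectors and the l1 norm\<close>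

lemma l1_norm_minus [simp]: "l1_norm (- x) = l1_norm x"
  by (simp add: l1_norm_def)

lemma l1_norm_scaleR [simp]: "l1_norm (c *\<^sub>R x) = \<bar>c\<bar> * l1_norm x"
  by (simp add: l1_norm_def abs_mult sum_distrib_left)

lemma l1_norm_linear_bound:
  fixes T :: "real ^ 'n \<Rightarrow> real ^ 'n"
  assumes "linear T"
  obtains B where "0 \<le> B" "\<And>w. l1_norm (T w) \<le> B * l1_norm w"
proof -
  obtain K where K: "0 < K" "\<And>w. norm (T w) \<le> K * norm w"
    using linear_bounded_pos[OF assms] by blast
  have "l1_norm (T w) \<le> real CARD('n) * K * l1_norm w" for w
  proof -
    have "l1_norm (T w) \<le> (\<Sum>i\<in>(UNIV::'n set). norm (T w))"
      unfolding l1_norm_def by (intro sum_mono component_le_norm_cart)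
    also have "\<dots> = real CARD('n) * norm (T w)" by simp
    also have "\<dots> \<le> real CARD('n) * (K * l1_norm w)"
    proof (rule mult_left_mono)
      have "norm w \<le> l1_norm w" using norm_le_l1_cart[of w] by (simp add: l1_norm_def)
      then show "norm (T w) \<le> K * l1_norm w"
        using K(2)[of w] mult_left_mono[of "norm w" "l1_norm w" K] K(1) by linarith
    qed simp
    finally show ?thesis by (simp add: mult.assoc)
  qed
  moreover have "0 \<le> real CARD('n) * K" using K(1) by simp
  ultimately show thesis using that by blast
qed

lemma l1_norm_cube: "w \<in> cube \<Longrightarrow> l1_norm (w :: real^'n) \<le> real CARD('n) / 2"
proof -
  assume w: "w \<in> cube"
  have "l1_norm w \<le> (\<Sum>i\<in>(UNIV::'n set). 1/2)"
    unfolding l1_norm_def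
  proof (rule sum_mono)
    fix i
    have "-1/2 \<le> w $ i" "w $ i < 1/2" using w by (auto simp: cube_def)
    then show "\<bar>w $ i\<bar> \<le> 1/2" by linarith
  qed
  then show ?thesis by simp
qed

lemma nonneg_nn_integral_count_space_finite:
  fixes f :: "'a \<Rightarrow> real"
  assumes "\<And>k. 0 \<le> f k" and fin: "(\<integral>\<^sup>+k. ennreal (f k) \<partial>count_space UNIV) < \<infinity>"
  shows "f summable_on UNIV"
    and "(\<integral>\<^sup>+k. ennreal (f k) \<partial>count_space UNIV) = ennreal (\<Sum>\<^sub>\<infinity>k. f k)"
proof -
  have int: "integrable (count_space UNIV) f"
    using assms by (intro integrableI_nonneg) auto
  then have abs: "Infinite_Set_Sum.abs_summable_on f UNIV"
    by (simp add: Infinite_Set_Sum.abs_summable_on_def)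
  then show "f summable_on UNIV"
    by (metis abs_summable_equivalent abs_summable_summable)
  have "(\<integral>\<^sup>+k. ennreal (f k) \<partial>count_space UNIV) = ennreal (integral\<^sup>L (count_space UNIV) f)"
    by (rule nn_integral_eq_integral[OF int]) (simp add: assms)
  then show "(\<integral>\<^sup>+k. ennreal (f k) \<partial>count_space UNIV) = ennreal (\<Sum>\<^sub>\<infinity>k. f k)"
    using infsetsum_infsum[OF abs] by (simp add: infsetsum_def)
qed

lemma borel_measurable_nn_integral_count_space:
  fixes f :: "'k::countable \<Rightarrow> 'a \<Rightarrow> ennreal"
  assumes "\<And>k. f k \<in> borel_measurable M"
  shows "(\<lambda>w. \<integral>\<^sup>+k. f k w \<partial>count_space UNIV) \<in> borel_measurable M"
proof -
  interpret sigma_finite_measure "count_space (UNIV :: 'k set)"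
    by (rule sigma_finite_measure_count_space_countable) simp
  show ?thesis
    by (intro borel_measurable_nn_integral, subst measurable_pair_swap_iff)
       (auto intro!: measurable_pair_measure_countable1 simp: assms)
qed


section \<open>Poisson summation over a lattice\<close>

definition tensor :: "(real \<Rightarrow> real) \<Rightarrow> real ^ 'n \<Rightarrow> real" where
  "tensor h x = (\<Prod>i\<in>UNIV. h (x $ i))"

text \<open>The sum of the tensor power of \<open>h\<close> over the lattice \<open>T (\<int>\<^sup>n)\<close> translated by \<open>v\<close>.\<close>
definition lattice_sum :: "(real \<Rightarrow> real) \<Rightarrow> (real ^ 'n \<Rightarrow> real ^ 'n) \<Rightarrow> real ^ 'n \<Rightarrow> real" where
  "lattice_sum h T v = (\<Sum>\<^sub>\<infinity>k. tensor h (T (ivec k) + v))"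

text \<open>The lattices are \<open>T (\<int>\<^sup>n)\<close> and its dual \<open>S (\<int>\<^sup>n)\<close>; the constant \<open>D\<close> is the covolume of the second.
  The test function \<open>g\<close> has Fourier transform \<open>gh\<close>. The Harnack-type condition \<open>g_harnack\<close>, which says
  that \<open>ln g\<close> is Lipschitz, makes lattice sums at nearby points comparable: it yields both their
  convergence and their continuity.\<close>
locale poisson_setting =
  fixes g gh :: "real \<Rightarrow> real" and A :: real
    and T S :: "real ^ 'n \<Rightarrow> real ^ 'n" and D :: real
  assumes g_pos: "0 < g x" and g_cont: "continuous_on UNIV g"
    and A_nonneg: "0 \<le> A"
    and g_harnack: "g (x + y) \<le> exp (A * \<bar>y\<bar>) * g x"
    and g_int: "integrable lborel g"
    and gh_nonneg: "0 \<le> gh y"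
    and g_fourier: "(\<integral>x. cis (2 * pi * (x * y)) * of_real (g x) \<partial>lborel) = of_real (gh y)"
    and lin: "linear T" and lin_S: "linear S" and dual: "T w \<bullet> S z = w \<bullet> z"
    and D_pos: "0 < D" and distr_T: "distr lborel borel T = density lborel (\<lambda>_. ennreal D)"
begin

abbreviation G :: "real ^ 'n \<Rightarrow> real" where "G \<equiv> tensor g"
abbreviation Gh :: "real ^ 'n \<Rightarrow> real" where "Gh \<equiv> tensor gh"
abbreviation \<theta> :: "real ^ 'n \<Rightarrow> real" where "\<theta> \<equiv> lattice_sum g T"

lemma G_pos: "0 < G x"
  by (simp add: tensor_def g_pos prod_pos)

lemma Gh_nonneg: "0 \<le> Gh y"
  by (simp add: tensor_def gh_nonneg prod_nonneg)

lemma g_measurable [measurable]: "g \<in> borel_measurable borel"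
  by (intro borel_measurable_continuous_onI g_cont)

lemma G_measurable [measurable]: "G \<in> borel_measurable borel"
  unfolding tensor_def[abs_def] by measurable

lemma T_measurable [measurable]: "T \<in> borel_measurable borel"
  by (intro borel_measurable_continuous_onI linear_continuous_on) (use lin linear_conv_bounded_linear in blast)

lemma G_harnack: "G (x + y) \<le> exp (A * l1_norm y) * G x"
proof -
  have "G (x + y) \<le> (\<Prod>i\<in>UNIV. exp (A * \<bar>y $ i\<bar>) * g (x $ i))"
    unfolding tensor_def by (intro prod_mono) (simp add: g_harnack g_pos less_imp_le)
  also have "\<dots> = exp (A * l1_norm y) * G x"
    by (simp add: prod.distrib tensor_def l1_norm_def sum_distrib_left exp_sum)
  finally show ?thesis .
qed

lemma G_integrable: "integrable lborel G"
  unfolding tensor_def[abs_def] by (rule integrable_prod_vec) (rule g_int)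

lemma fourier_G: "(\<integral>x. cis (2 * pi * (x \<bullet> y)) * of_real (G x) \<partial>lborel) = of_real (Gh y)"
proof -
  let ?\<phi> = "\<lambda>i t. cis (2 * pi * (t * y $ i)) * of_real (g t)"
  have m: "(\<lambda>t. cis (2 * pi * (t * c))) \<in> borel_measurable borel" for c :: real
    by (intro borel_measurable_continuous_onI) (auto intro!: continuous_intros)
  have i: "integrable lborel (?\<phi> i)" for i
    by (rule Bochner_Integration.integrable_bound[OF g_int]) (use m in \<open>auto simp: norm_mult\<close>)
  have eq: "(\<Prod>i\<in>UNIV. ?\<phi> i (x $ i)) = cis (2 * pi * (x \<bullet> y)) * of_real (G x)" for x
    by (simp add: prod.distrib tensor_def inner_vec_def sum_distrib_left cis_sum)
  have "(\<integral>x. (\<Prod>i\<in>UNIV. ?\<phi> i (x $ i)) \<partial>lborel) = (\<Prod>i\<in>UNIV. integral\<^sup>L lborel (?\<phi> i))"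
    by (rule integral_prod_vec[OF i])
  then show ?thesis unfolding eq g_fourier by (simp add: tensor_def)
qed

lemma cis_inner_measurable: "(\<lambda>x. cis (2 * pi * (x \<bullet> y))) \<in> borel_measurable borel" for y :: "real^'n"
  by (intro borel_measurable_continuous_onI) (auto intro!: continuous_intros)

lemma G_translate_integrable: "integrable lborel (\<lambda>x. G (x + v))"
proof -
  have "integrable (distr lborel borel ((+) v)) G"
    by (simp add: lborel_distr_plus G_integrable)
  then show ?thesis by (subst (asm) integrable_distr_eq) (auto simp: add.commute)
qed

lemma fourier_G_translate:
  "(\<integral>x. G (x + v) * cos (2 * pi * (x \<bullet> y)) \<partial>lborel) = cos (2 * pi * (v \<bullet> y)) * Gh y"
proof -
  let ?e = "\<lambda>x. cis (2 * pi * (x \<bullet> y))"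
  note [measurable] = cis_inner_measurable[of y]
  have int: "integrable lborel (\<lambda>x. ?e x * of_real (G (x + v)))"
    by (rule Bochner_Integration.integrable_bound[OF G_translate_integrable[of v]]) (auto simp: norm_mult)
  have "of_real (Gh y) = (\<integral>x. ?e x * of_real (G x) \<partial>distr lborel borel ((+) v))"
    by (simp add: lborel_distr_plus fourier_G)
  also have "\<dots> = (\<integral>x. ?e (v + x) * of_real (G (v + x)) \<partial>lborel)"
    by (subst integral_distr) auto
  also have "\<dots> = (\<integral>x. ?e v * (?e x * of_real (G (x + v))) \<partial>lborel)"
  proof -
    have "?e (v + x) * of_real (G (v + x)) = ?e v * (?e x * of_real (G (x + v)))" for x
      by (simp add: inner_add_left distrib_left add.commute[of v] mult_ac flip: cis_mult)
    then show ?thesis by (simp only:)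
  qed
  also have "\<dots> = ?e v * (\<integral>x. ?e x * of_real (G (x + v)) \<partial>lborel)"
    by (rule integral_mult_right_zero)
  finally have "cnj (?e v) * of_real (Gh y) = (cnj (?e v) * ?e v) * (\<integral>x. ?e x * of_real (G (x + v)) \<partial>lborel)"
    by (simp add: mult.assoc)
  also have "cnj (?e v) * ?e v = 1" by (simp add: cis_cnj cis_mult)
  finally have "(\<integral>x. ?e x * of_real (G (x + v)) \<partial>lborel) = cnj (?e v) * of_real (Gh y)" by simp
  then have re: "Re (\<integral>x. ?e x * of_real (G (x + v)) \<partial>lborel) = cos (2 * pi * (v \<bullet> y)) * Gh y" by simp
  have "(\<integral>x. G (x + v) * cos (2 * pi * (x \<bullet> y)) \<partial>lborel) = (\<integral>x. Re (?e x * of_real (G (x + v))) \<partial>lborel)"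
    by (simp add: mult.commute)
  also have "\<dots> = Re (\<integral>x. ?e x * of_real (G (x + v)) \<partial>lborel)"
    by (rule integral_Re[OF int])
  finally show ?thesis unfolding re .
qed

text \<open>Substituting \<open>x = T w\<close> turns the frequency \<open>z\<close> into \<open>S z\<close>, because \<open>w \<bullet> z = T w \<bullet> S z\<close>.\<close>
lemma fourier_G_lattice:
  shows "integrable lborel (\<lambda>w. G (T w + v) * cos (2 * pi * (w \<bullet> z)))"
    and "(\<integral>w. G (T w + v) * cos (2 * pi * (w \<bullet> z)) \<partial>lborel) = D * (cos (2 * pi * (v \<bullet> S z)) * Gh (S z))"
proof -
  let ?f = "\<lambda>x. G (x + v) * cos (2 * pi * (x \<bullet> S z))"
  have fm[measurable]: "?f \<in> borel_measurable borel"
    by (intro borel_measurable_times) (auto intro!: borel_measurable_continuous_onI continuous_intros)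
  have int: "integrable lborel ?f"
    by (rule Bochner_Integration.integrable_bound[OF G_translate_integrable[of v]])
       (auto simp: abs_mult mult_left_le)
  have i2: "integrable (distr lborel borel T) ?f"
    unfolding distr_T using int D_pos by (subst integrable_density) auto
  have eq: "?f (T w) = G (T w + v) * cos (2 * pi * (w \<bullet> z))" for w by (simp add: dual)
  show "integrable lborel (\<lambda>w. G (T w + v) * cos (2 * pi * (w \<bullet> z)))"
    using i2 by (subst (asm) integrable_distr_eq) (auto simp: eq)
  have "(\<integral>w. G (T w + v) * cos (2 * pi * (w \<bullet> z)) \<partial>lborel) = integral\<^sup>L (distr lborel borel T) ?f"
    by (subst integral_distr) (auto simp: eq)
  also have "\<dots> = D * integral\<^sup>L lborel ?f"
    unfolding distr_T using D_pos by (subst integral_density) auto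
  finally show "(\<integral>w. G (T w + v) * cos (2 * pi * (w \<bullet> z)) \<partial>lborel) = D * (cos (2 * pi * (v \<bullet> S z)) * Gh (S z))"
    by (simp add: fourier_G_translate)
qed

text \<open>By the Harnack condition the sum at \<open>v\<close> is at most a constant times the sum at any point of the cell
  around it. Averaged over the cell, the latter is the integral of \<open>G\<close> over the whole space.\<close>
lemma orbit_sum_finite: "(\<integral>\<^sup>+k. ennreal (G (T (ivec k) + v)) \<partial>count_space UNIV) < \<infinity>"
proof -
  let ?C = "count_space (UNIV :: ('n \<Rightarrow> int) set)"
  let ?\<Phi> = "\<lambda>w. \<integral>\<^sup>+k. ennreal (G (T (w + ivec k) + v)) \<partial>?C"
  obtain B where B: "0 \<le> B" "\<And>w. l1_norm (T w) \<le> B * l1_norm w"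
    using l1_norm_linear_bound[OF lin] by blast
  define c where "c = exp (A * (B * (real CARD('n) / 2)))"
  have cmp: "?\<Phi> 0 \<le> ennreal c * ?\<Phi> w" if "w \<in> cube" for w
  proof -
    have "G (T (0 + ivec k) + v) \<le> c * G (T (w + ivec k) + v)" for k
    proof -
      have "G (T (ivec k) + v) \<le> exp (A * l1_norm (- T w)) * G (T (w + ivec k) + v)"
        using G_harnack[of "T (w + ivec k) + v" "- T w"] by (simp add: linear_add[OF lin])
      also have "\<dots> \<le> c * G (T (w + ivec k) + v)"
      proof (rule mult_right_mono)
        have "l1_norm (T w) \<le> B * (real CARD('n) / 2)"
          using B(2)[of w] mult_left_mono[OF l1_norm_cube[OF that] B(1)] by linarith
        then have "A * l1_norm (T w) \<le> A * (B * (real CARD('n) / 2))"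
          by (rule mult_left_mono) (rule A_nonneg)
        then show "exp (A * l1_norm (- T w)) \<le> c" unfolding c_def by simp
      qed (simp add: G_pos less_imp_le)
      finally show ?thesis by simp
    qed
    then have "?\<Phi> 0 \<le> (\<integral>\<^sup>+k. ennreal c * ennreal (G (T (w + ivec k) + v)) \<partial>?C)"
      by (intro nn_integral_mono) (simp add: c_def ennreal_mult'[symmetric] ennreal_leI)
    also have "\<dots> = ennreal c * ?\<Phi> w" by (rule nn_integral_cmult) simp
    finally show ?thesis .
  qed
  have meas\<Phi>[measurable]: "?\<Phi> \<in> borel_measurable borel"
    by (intro borel_measurable_nn_integral_count_space) measurable
  have "?\<Phi> 0 = (\<integral>\<^sup>+w. indicator cube (w :: real^'n) * ?\<Phi> 0 \<partial>lborel)"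
  proof -
    \<comment> \<open>The cube has volume \<open>1\<close>, read off from the Fejer kernel of order \<open>1\<close>, which is constant.\<close>
    have "has_bochner_integral lborel (\<lambda>w :: real^'n. indicator cube w * fejer_vec 1 w) 1"
      by (rule integral_fejer_vec) simp
    moreover have "fejer_vec 1 w = 1" for w :: "real^'n" by (simp add: fejer_vec_def fejer_def)
    ultimately have "has_bochner_integral lborel (indicator (cube :: (real^'n) set)) (1::real)" by simp
    then have "(\<integral>\<^sup>+w. ennreal (indicator (cube :: (real^'n) set) w) \<partial>lborel) = ennreal 1"
      by (subst nn_integral_eq_integral) (auto simp: has_bochner_integral_iff)
    then show ?thesis by (subst nn_integral_multc) (auto simp: ennreal_indicator)
  qed
  also have "\<dots> \<le> (\<integral>\<^sup>+w. ennreal c * (indicator cube w * ?\<Phi> w) \<partial>lborel)"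
  proof (rule nn_integral_mono)
    fix w
    show "indicator cube w * ?\<Phi> 0 \<le> ennreal c * (indicator cube w * ?\<Phi> w)"
      using cmp[of w] by (cases "w \<in> cube") simp_all
  qed
  also have "\<dots> = ennreal c * (\<integral>\<^sup>+w. indicator cube w * ?\<Phi> w \<partial>lborel)"
    by (rule nn_integral_cmult) measurable
  also have "(\<integral>\<^sup>+w. indicator cube w * ?\<Phi> w \<partial>lborel) = (\<integral>\<^sup>+w. ennreal (G (T w + v)) \<partial>lborel)"
    by (rule nn_integral_tiling[of "\<lambda>w. ennreal (G (T w + v))", symmetric]) measurable
  also have "ennreal c * \<dots> < \<infinity>"
  proof -
    have "integrable lborel (\<lambda>w. G (T w + v))"
      using fourier_G_lattice(1)[of v 0] by simp
    then have "(\<integral>\<^sup>+w. ennreal (G (T w + v)) \<partial>lborel) < \<infinity>"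
      by (simp add: integrable_iff_bounded G_pos less_imp_le)
    then show ?thesis by (simp add: ennreal_mult_less_top)
  qed
  finally show ?thesis by simp
qed

lemmas orbit_summable = nonneg_nn_integral_count_space_finite(1)[OF less_imp_le[OF G_pos] orbit_sum_finite]
lemmas orbit_nn_integral = nonneg_nn_integral_count_space_finite(2)[OF less_imp_le[OF G_pos] orbit_sum_finite, folded lattice_sum_def]

lemma \<theta>_nonneg: "0 \<le> \<theta> v"
  unfolding lattice_sum_def by (intro infsum_nonneg) (simp add: G_pos less_imp_le)

lemma \<theta>_harnack: "\<theta> (v + u) \<le> exp (A * l1_norm u) * \<theta> v"
proof -
  have "\<theta> (v + u) \<le> (\<Sum>\<^sub>\<infinity>k. exp (A * l1_norm u) * G (T (ivec k) + v))"
    unfolding lattice_sum_def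
    by (intro infsum_mono orbit_summable summable_on_cmult_right)
       (use G_harnack[of "T (ivec _) + v" u] in \<open>simp add: add.assoc\<close>)
  also have "\<dots> = exp (A * l1_norm u) * \<theta> v"
    unfolding lattice_sum_def by (intro infsum_cmult_right orbit_summable)
  finally show ?thesis .
qed

lemma orbit_at: "(\<integral>\<^sup>+k. ennreal (G (T (w + ivec k) + v)) \<partial>count_space UNIV) = ennreal (\<theta> (T w + v))"
  using orbit_nn_integral[of "T w + v"] by (simp add: linear_add[OF lin] add_ac)

lemma \<theta>_measurable: "(\<lambda>w. \<theta> (T w + v)) \<in> borel_measurable borel"
proof -
  have "(\<lambda>w. enn2real (\<integral>\<^sup>+k. ennreal (G (T (w + ivec k) + v)) \<partial>count_space UNIV)) \<in> borel_measurable borel"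
    by (intro borel_measurable_enn2real borel_measurable_nn_integral_count_space) measurable
  then show ?thesis unfolding orbit_at by (simp add: \<theta>_nonneg)
qed

text \<open>By periodicity of the kernel, the mean over one cell of the lattice sum is an integral of \<open>G\<close> against
  the kernel over the whole space, and expanding the kernel leaves finitely many values of the Fourier
  transform of \<open>G\<close>.\<close>
lemma fejer_mean_eq:
  assumes N: "N > 0"
  shows "(\<integral>w. indicator cube w * \<theta> (T w + v) * fejer_vec N w \<partial>lborel)
    = (\<Sum>k\<in>int_box N. fejer_weight N k * (cos (2 * pi * (v \<bullet> S (ivec k))) * (D * Gh (S (ivec k)))))"
proof -
  note [measurable] = \<theta>_measurable[of v]
  have "(\<integral>w. indicator cube w * \<theta> (T w + v) * fejer_vec N w \<partial>lborel)
      = enn2real (\<integral>\<^sup>+w. ennreal (indicator cube w * \<theta> (T w + v) * fejer_vec N w) \<partial>lborel)"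
    by (rule integral_eq_nn_integral) (auto simp: \<theta>_nonneg fejer_vec_nonneg)
  also have "(\<integral>\<^sup>+w. ennreal (indicator cube w * \<theta> (T w + v) * fejer_vec N w) \<partial>lborel)
      = (\<integral>\<^sup>+w. indicator cube w * (\<integral>\<^sup>+k. ennreal (G (T (w + ivec k) + v) * fejer_vec N (w + ivec k)) \<partial>count_space UNIV) \<partial>lborel)"
  proof (rule nn_integral_cong)
    fix w
    have "(\<integral>\<^sup>+k. ennreal (G (T (w + ivec k) + v) * fejer_vec N (w + ivec k)) \<partial>count_space UNIV)
        = (\<integral>\<^sup>+k. ennreal (G (T (w + ivec k) + v)) * ennreal (fejer_vec N w) \<partial>count_space UNIV)"
      by (simp add: fejer_vec_periodic ennreal_mult' fejer_vec_nonneg ennreal_mult'')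
    also have "\<dots> = ennreal (\<theta> (T w + v)) * ennreal (fejer_vec N w)"
      by (subst nn_integral_multc) (auto simp: orbit_at)
    finally show "ennreal (indicator cube w * \<theta> (T w + v) * fejer_vec N w)
        = indicator cube w * (\<integral>\<^sup>+k. ennreal (G (T (w + ivec k) + v) * fejer_vec N (w + ivec k)) \<partial>count_space UNIV)"
      by (simp add: ennreal_mult' \<theta>_nonneg fejer_vec_nonneg ennreal_mult'' ennreal_indicator mult.assoc indicator_def)
  qed
  also have "\<dots> = (\<integral>\<^sup>+w. ennreal (G (T w + v) * fejer_vec N w) \<partial>lborel)"
    by (rule nn_integral_tiling[of "\<lambda>w. ennreal (G (T w + v) * fejer_vec N w)", symmetric]) measurable
  also have "enn2real \<dots> = (\<integral>w. G (T w + v) * fejer_vec N w \<partial>lborel)"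
    by (rule integral_eq_nn_integral[symmetric]) (auto simp: G_pos less_imp_le fejer_vec_nonneg)
  also have "\<dots> = (\<integral>w. (\<Sum>k\<in>int_box N. fejer_weight N k * (G (T w + v) * cos (2 * pi * (w \<bullet> ivec k)))) \<partial>lborel)"
    unfolding fejer_vec_expand[OF N] by (simp only: sum_distrib_left mult.left_commute)
  also have "\<dots> = (\<Sum>k\<in>int_box N. fejer_weight N k * (\<integral>w. G (T w + v) * cos (2 * pi * (w \<bullet> ivec k)) \<partial>lborel))"
    by (subst Bochner_Integration.integral_sum) (auto intro!: integrable_mult_right fourier_G_lattice(1))
  finally show ?thesis unfolding fourier_G_lattice(2) by (simp only: mult.left_commute)
qed

text \<open>The Harnack condition passes from \<open>g\<close> to \<open>\<theta>\<close>, which is therefore Lipschitz at every point.\<close>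
lemma fejer_mean_\<theta>:
  "(\<lambda>N. \<Sum>k\<in>int_box N. fejer_weight N k * (cos (2 * pi * (v \<bullet> S (ivec k))) * (D * Gh (S (ivec k)))))
     \<longlonglongrightarrow> \<theta> v"
proof -
  obtain B where B: "0 \<le> B" "\<And>w. l1_norm (T w) \<le> B * l1_norm w"
    using l1_norm_linear_bound[OF lin] by blast
  define C where "C = \<theta> v * (A * B * exp (A * (B * (real CARD('n) / 2))))"
  have "(\<lambda>N. \<integral>w. indicator cube w * \<theta> (T w + v) * fejer_vec N w \<partial>lborel) \<longlonglongrightarrow> \<theta> (T 0 + v)"
  proof (rule fejer_mean_tendsto[where C = C])
    fix w :: "real ^ 'n" assume w: "w \<in> cube"
    define t where "t = A * l1_norm (T w)"
    have t0: "0 \<le> t" unfolding t_def by (intro mult_nonneg_nonneg A_nonneg l1_norm_nonneg)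
    have up: "\<theta> (T w + v) \<le> exp t * \<theta> v"
      using \<theta>_harnack[of v "T w"] by (simp add: t_def add.commute)
    have low: "\<theta> v \<le> exp t * \<theta> (T w + v)"
      using \<theta>_harnack[of "T w + v" "- T w"] by (simp add: t_def)
    have "\<bar>\<theta> (T w + v) - \<theta> v\<bar> \<le> \<theta> v * (exp t - 1)"
    proof -
      have "exp (- t) * \<theta> v \<le> exp (- t) * (exp t * \<theta> (T w + v))" by (rule mult_left_mono[OF low]) simp
      also have "\<dots> = \<theta> (T w + v)" by (simp add: exp_minus)
      finally have "exp (- t) * \<theta> v \<le> \<theta> (T w + v)" .
      moreover have "2 - exp t \<le> exp (- t)"
        using cosh_real_ge_1[of t] by (simp add: cosh_field_def)
      then have "(2 - exp t) * \<theta> v \<le> exp (- t) * \<theta> v"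
        by (rule mult_right_mono) (rule \<theta>_nonneg)
      ultimately show ?thesis using up by (simp add: abs_le_iff algebra_simps)
    qed
    also have "\<dots> \<le> \<theta> v * ((A * (B * l1_norm w)) * exp (A * (B * (real CARD('n) / 2))))"
    proof (rule mult_left_mono[OF _ \<theta>_nonneg])
      have "exp t * (1 + (- t)) \<le> exp t * exp (- t)" by (intro mult_left_mono exp_ge_add_one_self) simp
      then have "exp t - 1 \<le> t * exp t" by (simp add: exp_minus algebra_simps)
      also have "\<dots> \<le> (A * (B * l1_norm w)) * exp (A * (B * (real CARD('n) / 2)))"
      proof (rule mult_mono)
        show 1: "t \<le> A * (B * l1_norm w)" unfolding t_def by (intro mult_left_mono B A_nonneg)
        have "A * (B * l1_norm w) \<le> A * (B * (real CARD('n) / 2))"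
          by (intro mult_left_mono l1_norm_cube w A_nonneg B)
        with 1 show "exp t \<le> exp (A * (B * (real CARD('n) / 2)))" by simp
      qed (use A_nonneg B l1_norm_nonneg[of w] in auto)
      finally show "exp t - 1 \<le> (A * (B * l1_norm w)) * exp (A * (B * (real CARD('n) / 2)))" .
    qed
    finally show "\<bar>\<theta> (T w + v) - \<theta> (T 0 + v)\<bar> \<le> C * l1_norm w"
      by (simp add: linear_0[OF lin] C_def mult_ac)
  qed (rule \<theta>_measurable)
  then have "(\<lambda>N. \<integral>w. indicator cube w * \<theta> (T w + v) * fejer_vec N w \<partial>lborel) \<longlonglongrightarrow> \<theta> v"
    by (simp add: linear_0[OF lin])
  then show ?thesis
    by (rule Lim_transform_eventually)
       (auto intro!: eventually_sequentiallyI[of 1] simp: fejer_mean_eq linear_0[OF lin])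
qed

lemma fejer_mean_\<theta>_0:
  "(\<lambda>N. \<Sum>k\<in>int_box N. fejer_weight N k * (D * Gh (S (ivec k)))) \<longlonglongrightarrow> \<theta> 0"
  using fejer_mean_\<theta>[of 0] by simp

text \<open>All terms are nonnegative. Finite partial sums are therefore limits of parts of the Fejer means, which
  bounds the series by \<open>\<theta> 0\<close>, and the Fejer means themselves are bounded by the series because their
  weights are at most \<open>1\<close>.\<close>
theorem poisson_at_0: "((\<lambda>k. D * Gh (S (ivec k))) has_sum \<theta> 0) UNIV"
proof -
  let ?c = "\<lambda>k. D * Gh (S (ivec k))"
  have c0: "0 \<le> ?c k" for k using D_pos Gh_nonneg by simp
  have part: "sum ?c F \<le> \<theta> 0" if F: "finite F" for F
  proof (rule LIMSEQ_le)
    show "(\<lambda>N. \<Sum>k\<in>F. fejer_weight N k * ?c k) \<longlonglongrightarrow> sum ?c F"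
      using tendsto_sum[of F "\<lambda>k N. fejer_weight N k * ?c k" "\<lambda>k. 1 * ?c k" sequentially]
      by (simp add: tendsto_mult_right fejer_weight_tendsto[THEN tendsto_mult_right, simplified] tendsto_eq_rhs[OF tendsto_mult_right[OF fejer_weight_tendsto]])
    show "(\<lambda>N. \<Sum>k\<in>int_box N. fejer_weight N k * ?c k) \<longlonglongrightarrow> \<theta> 0" by (rule fejer_mean_\<theta>_0)
    \<comment> \<open>A crude bound for all coordinates of all members of \<open>F\<close>.\<close>
    define M where "M = nat (\<Sum>k\<in>F. \<Sum>i\<in>UNIV. \<bar>k i\<bar>)"
    have "F \<subseteq> int_box N" if N: "M \<le> N" for N
    proof
      fix k assume k: "k \<in> F"
      show "k \<in> int_box N" unfolding in_int_box
      proof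
        fix i
        have "\<bar>k i\<bar> \<le> (\<Sum>i\<in>UNIV. \<bar>k i\<bar>)" by (rule member_le_sum) auto
        also have "\<dots> \<le> (\<Sum>k\<in>F. \<Sum>i\<in>UNIV. \<bar>k i\<bar>)"
          by (rule member_le_sum[OF k]) (use F in \<open>auto intro: sum_nonneg\<close>)
        finally show "\<bar>k i\<bar> \<le> int N" using N by (simp add: M_def)
      qed
    qed
    then show "\<exists>M. \<forall>N\<ge>M. (\<Sum>k\<in>F. fejer_weight N k * ?c k) \<le> (\<Sum>k\<in>int_box N. fejer_weight N k * ?c k)"
      by (intro exI[of _ M] allI impI sum_mono2 finite_int_box) (auto simp: c0 fejer_weight_bounds)
  qed
  have sm: "?c summable_on UNIV"
    by (rule nonneg_bounded_partial_sums_imp_summable_on[where C = "\<theta> 0"]) (auto simp: c0 part)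
  have "infsum ?c UNIV \<le> \<theta> 0"
    by (rule infsum_le_finite_sums[OF sm]) (rule part)
  moreover have "\<theta> 0 \<le> infsum ?c UNIV"
  proof (rule LIMSEQ_le_const2[OF fejer_mean_\<theta>_0], intro exI allI impI)
    fix N :: nat
    have "(\<Sum>k\<in>int_box N. fejer_weight N k * ?c k) \<le> sum ?c (int_box N)"
      by (intro sum_mono mult_left_le_one_le c0) (auto simp: fejer_weight_bounds)
    also have "\<dots> \<le> infsum ?c UNIV"
      by (rule finite_sum_le_infsum[OF sm]) (auto simp: finite_int_box c0)
    finally show "(\<Sum>k\<in>int_box N. fejer_weight N k * ?c k) \<le> infsum ?c UNIV" .
  qed
  ultimately show ?thesis using has_sum_infsum[OF sm] by simp
qed

text \<open>In the Fejer means the zero frequency has weight \<open>1\<close> and contributes \<open>D * Gh 0\<close>; the other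
  frequencies enter with a cosine factor at \<open>v\<close>, and with that factor replaced by \<open>1\<close> at \<open>0\<close>.\<close>
theorem poisson_deviation: "\<bar>\<theta> v - D * Gh 0\<bar> \<le> \<theta> 0 - D * Gh 0"
proof -
  let ?c = "\<lambda>k. D * Gh (S (ivec k))"
  let ?z = "(\<lambda>_. 0) :: 'n \<Rightarrow> int"
  have c0: "0 \<le> ?c k" for k using D_pos Gh_nonneg by simp
  have S0: "S 0 = 0" by (rule linear_0[OF lin_S])
  have iz: "ivec ?z = 0" by (simp add: vec_eq_iff)
  have zin: "?z \<in> int_box N" for N by (simp add: in_int_box)
  have split: "(\<Sum>k\<in>int_box N. fejer_weight N k * (cos (2 * pi * (u \<bullet> S (ivec k))) * ?c k)) - D * Gh 0
      = (\<Sum>k\<in>int_box N - {?z}. fejer_weight N k * (cos (2 * pi * (u \<bullet> S (ivec k))) * ?c k))" for u N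
    by (subst sum.remove[OF finite_int_box zin]) (simp add: iz S0)
  show ?thesis
  proof (rule LIMSEQ_le)
    show "(\<lambda>N. \<bar>(\<Sum>k\<in>int_box N. fejer_weight N k * (cos (2 * pi * (v \<bullet> S (ivec k))) * ?c k)) - D * Gh 0\<bar>)
        \<longlonglongrightarrow> \<bar>\<theta> v - D * Gh 0\<bar>"
      by (intro tendsto_intros fejer_mean_\<theta>)
    show "(\<lambda>N. (\<Sum>k\<in>int_box N. fejer_weight N k * (cos (2 * pi * (0 \<bullet> S (ivec k))) * ?c k)) - D * Gh 0)
        \<longlonglongrightarrow> \<theta> 0 - D * Gh 0"
      by (intro tendsto_intros fejer_mean_\<theta>)
    have "\<bar>\<Sum>k\<in>int_box N - {?z}. fejer_weight N k * (cos (2 * pi * (v \<bullet> S (ivec k))) * ?c k)\<bar>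
        \<le> (\<Sum>k\<in>int_box N - {?z}. fejer_weight N k * (cos (2 * pi * (0 \<bullet> S (ivec k))) * ?c k))" for N
    proof (rule order_trans[OF sum_abs sum_mono])
      fix k assume "k \<in> int_box N - {?z}"
      then have "0 \<le> fejer_weight N k * ?c k"
        by (intro mult_nonneg_nonneg c0 fejer_weight_bounds(1)) simp
      then have "\<bar>fejer_weight N k * (cos (2 * pi * (v \<bullet> S (ivec k))) * ?c k)\<bar>
          = \<bar>cos (2 * pi * (v \<bullet> S (ivec k)))\<bar> * (fejer_weight N k * ?c k)"
        by (subst mult.left_commute) (simp only: abs_mult[of "cos _"] abs_of_nonneg)
      also have "\<dots> \<le> 1 * (fejer_weight N k * ?c k)"
        by (rule mult_right_mono) (use \<open>0 \<le> fejer_weight N k * ?c k\<close> in auto)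
      finally show "\<bar>fejer_weight N k * (cos (2 * pi * (v \<bullet> S (ivec k))) * ?c k)\<bar>
          \<le> fejer_weight N k * (cos (2 * pi * (0 \<bullet> S (ivec k))) * ?c k)" by simp
    qed
    then show "\<exists>M. \<forall>N\<ge>M. \<bar>(\<Sum>k\<in>int_box N. fejer_weight N k * (cos (2 * pi * (v \<bullet> S (ivec k))) * ?c k)) - D * Gh 0\<bar>
        \<le> (\<Sum>k\<in>int_box N. fejer_weight N k * (cos (2 * pi * (0 \<bullet> S (ivec k))) * ?c k)) - D * Gh 0"
      unfolding split by blast
  qed
qed

end

section \<open>Decay of functions under scaling\<close>

text \<open>The slope condition says that \<open>h x * x powr (- b) * exp (a x)\<close> is nonincreasing for positive \<open>x\<close>, and
  the conclusion compares the values of that function at \<open>s x\<close> and \<open>x\<close>. The choice \<open>a = b = 0\<close> gives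
  plain monotonicity.\<close>
lemma log_slope_decay:
  fixes h h' :: "real \<Rightarrow> real"
  assumes pos: "\<And>x. 0 < h x" and even: "\<And>x. h (- x) = h x"
    and der: "\<And>x. 0 < x \<Longrightarrow> (h has_real_derivative h' x) (at x)"
    and slope: "\<And>x. 0 < x \<Longrightarrow> x * h' x \<le> (b - a * x) * h x"
    and b: "0 \<le> b" and s: "0 < s" "s \<le> 1"
  shows "h x \<le> h (s * x) * exp (b * ln (1 / s) - a * (1 - s) * \<bar>x\<bar>)"
proof -
  have main: "h x \<le> h (s * x) * exp (b * ln (1 / s) - a * (1 - s) * x)" if x: "0 < x" for x
  proof -
    let ?\<phi> = "\<lambda>t. ln (h t) + a * t - b * ln t"
    have "?\<phi> x \<le> ?\<phi> (s * x)"
    proof (rule DERIV_nonpos_imp_nonincreasing[of "s * x" x ?\<phi>])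
      show "s * x \<le> x" using s x by simp
      fix t assume "s * x \<le> t"
      then have t: "0 < t" using s x mult_pos_pos[of s x] by linarith
      have "(?\<phi> has_real_derivative (h' t / h t + a - b / t)) (at t)"
        using t pos[of t] der[OF t] by (auto intro!: derivative_eq_intros simp: divide_inverse mult_ac)
      moreover have "h' t / h t + a - b / t \<le> 0"
      proof -
        have "h' t / h t + a - b / t = (t * h' t - (b - a * t) * h t) / (t * h t)"
          using t pos[of t] by (simp add: field_simps)
        also have "\<dots> \<le> 0"
          using slope[OF t] t pos[of t] by (intro divide_nonpos_pos) auto
        finally show ?thesis .
      qed
      ultimately show "\<exists>y. (?\<phi> has_real_derivative y) (at t) \<and> y \<le> 0" by blast
    qed
    then have "ln (h x) \<le> ln (h (s * x)) + (b * ln (1 / s) - a * (1 - s) * x)"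
      using s x by (simp add: ln_mult ln_div algebra_simps)
    then have "exp (ln (h x)) \<le> exp (ln (h (s * x)) + (b * ln (1 / s) - a * (1 - s) * x))" by simp
    then show ?thesis using pos by (simp add: exp_add)
  qed
  consider "x = 0" | "0 < x" | "0 < - x" by linarith
  then show ?thesis
  proof cases
    case 1
    have "h 0 * 1 \<le> h 0 * exp (b * ln (1 / s))"
      using b s pos[of 0] by (intro mult_left_mono) (auto simp: ln_div mult_le_0_iff)
    with 1 show ?thesis by simp
  next
    case 2
    then show ?thesis using main by simp
  next
    case 3
    then show ?thesis using main[OF 3] even[of x] even[of "s * x"] by simp
  qed
qed

lemma tensor_mono_factor:
  assumes "\<And>t. 0 \<le> h t" "\<And>t. h t \<le> h (s * t) * exp (p - q * \<bar>t\<bar>)"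
  shows "tensor h x \<le> tensor h (s *\<^sub>R x) * exp (real CARD('n) * p - q * l1_norm (x :: real ^ 'n))"
proof -
  have "tensor h x \<le> (\<Prod>i\<in>UNIV. h (s * x $ i) * exp (p - q * \<bar>x $ i\<bar>))"
    unfolding tensor_def using assms by (intro prod_mono) auto
  also have "\<dots> = tensor h (s *\<^sub>R x) * exp (\<Sum>i\<in>UNIV. p - q * \<bar>x $ i\<bar>)"
    by (simp add: prod.distrib tensor_def exp_sum)
  also have "(\<Sum>i\<in>UNIV. p - q * \<bar>x $ i\<bar>) = real CARD('n) * p - q * l1_norm x"
    by (simp add: sum_subtractf l1_norm_def sum_distrib_left)
  finally show ?thesis .
qed


section \<open>The squared hyperbolic secant and its transform\<close>

definition sech_sq :: "real \<Rightarrow> real" where "sech_sq x = 1 / (cosh x)\<^sup>2"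

text \<open>With \<open>u = 2 x\<close> the claim reads \<open>u \<le> 0.28 (exp u + 1)\<close>, which follows from the tangent of \<open>exp\<close> at
  \<open>1.28\<close> because \<open>exp 1.28 \<ge> 1 / 0.28\<close>. The constant \<open>0.56\<close> is close to the optimal \<open>0.5569\<close>.\<close>
lemma sech_sq_slope: "2 * x * sinh x / cosh x \<ge> 2 * x - 0.56" if "0 < x" for x :: real
proof -
  define E where "E = exp (2 * x)"
  have e1: "25 / 7 \<le> exp (1.28 :: real)"
  proof -
    have "1 + 0.16 + 0.16\<^sup>2 / 2 \<le> exp (0.16 :: real)" by (rule exp_lower_Taylor_quadratic) simp
    then have "(1 + 0.16 + 0.16\<^sup>2 / 2) ^ 8 \<le> exp (0.16 :: real) ^ 8" by (rule power_mono) simp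
    also have "\<dots> = exp (1.28 :: real)" by (simp flip: exp_of_nat_mult)
    finally show ?thesis by (simp add: power2_eq_square eval_nat_numeral)
  qed
  have e2: "exp 1.28 * (2 * x - 0.28) \<le> E"
  proof -
    have "exp 1.28 * (1 + (2 * x - 1.28)) \<le> exp 1.28 * exp (2 * x - 1.28)"
      by (intro mult_left_mono exp_ge_add_one_self) simp
    then show ?thesis by (simp add: E_def flip: exp_add)
  qed
  have key: "2 * x \<le> 0.28 * (E + 1)"
  proof (cases "0.28 \<le> 2 * x")
    case True
    then have "25 / 7 * (2 * x - 0.28) \<le> exp 1.28 * (2 * x - 0.28)"
      by (intro mult_right_mono e1) auto
    then have "25 / 7 * (2 * x - 0.28) \<le> E" using e2 by (rule order_trans)
    then show ?thesis by simp
  next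
    case False
    have "0 < E" by (simp add: E_def)
    with False show ?thesis by simp
  qed
  have th: "sinh x / cosh x = (E - 1) / (E + 1)"
  proof -
    have "2 * sinh x = exp x - exp (- x)" "2 * cosh x = exp x + exp (- x)"
      by (simp_all add: sinh_field_def cosh_field_def)
    moreover have "sinh x / cosh x = (exp x * (2 * sinh x)) / (exp x * (2 * cosh x))" by simp
    ultimately have "sinh x / cosh x = (exp x * (exp x - exp (- x))) / (exp x * (exp x + exp (- x)))"
      by (simp only:)
    also have "\<dots> = (E - 1) / (E + 1)"
      by (simp add: E_def algebra_simps flip: exp_add)
    finally show ?thesis .
  qed
  have "2 * x * sinh x / cosh x = 2 * x * (sinh x / cosh x)" by simp
  also have "\<dots> = 2 * x - 4 * x / (E + 1)"
  proof -
    have "0 < E + 1" by (simp add: E_def add_pos_pos)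
    then show ?thesis unfolding th by (simp add: field_simps)
  qed
  finally have "2 * x * sinh x / cosh x = 2 * x - 4 * x / (E + 1)" .
  moreover have "4 * x / (E + 1) \<le> 0.56"
    using key by (simp add: E_def field_simps add_pos_pos)
  ultimately show ?thesis by simp
qed

lemma sech_sq_decay:
  assumes s: "0 < s" "s \<le> 1" and ab: "a = 2 \<and> b = 0.56 \<or> a = 0 \<and> b = 0"
  shows "sech_sq x \<le> sech_sq (s * x) * exp (b * ln (1 / s) - a * (1 - s) * \<bar>x\<bar>)"
proof (rule log_slope_decay[OF _ _ _ _ _ s])
  fix x :: real
  show "0 < sech_sq x" "sech_sq (- x) = sech_sq x" by (simp_all add: sech_sq_def)
  assume x: "0 < x"
  show "(sech_sq has_real_derivative (- (2 * sinh x / cosh x)) * sech_sq x) (at x)"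
    unfolding sech_sq_def[abs_def]
    by (auto intro!: derivative_eq_intros simp: power2_eq_square field_simps)
  have "a * x - b \<le> 2 * x * sinh x / cosh x"
    using ab sech_sq_slope[OF x] x by auto
  then have "(a * x - b) * sech_sq x \<le> 2 * x * sinh x / cosh x * sech_sq x"
    by (rule mult_right_mono) (simp add: sech_sq_def)
  then show "x * (- (2 * sinh x / cosh x) * sech_sq x) \<le> (b - a * x) * sech_sq x"
    by (simp add: algebra_simps)
qed (use ab in auto)

text \<open>With \<open>u = 2 z\<close> the claim reads \<open>(0.245 - 0.05 u) (exp u - 1) \<le> u\<close>. The difference of the sides has
  derivative \<open>0.95 - 0.05 (3.9 - u) exp u\<close>, which is nonnegative because \<open>(3.9 - u) exp u \<le> exp 2.9 \<le> 19\<close>.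
  The line \<open>0.245 + 0.9 z\<close> is chosen so that \<open>(1 + b) / a = 1.755 / 0.9 = 1.95\<close> is close to the least
  possible value \<open>1.915\<close>, the solution of \<open>z coth z = 2\<close>.\<close>
lemma z_cosh_bound: "(0.245 + 0.9 * z) * sinh z \<le> z * cosh z" if z: "0 < z" for z :: real
proof -
  let ?f = "\<lambda>u::real. u - (0.245 - 0.05 * u) * (exp u - 1)"
  have e29: "exp (2.9 :: real) \<le> 19"
  proof -
    have "exp (2.9 :: real) * exp 0.1 = exp 1 ^ 3" by (simp flip: exp_add exp_of_nat_mult)
    also have "\<dots> \<le> (272/100) ^ 3" using e_less_272 by (intro power_mono) auto
    finally have "exp (2.9 :: real) * exp 0.1 \<le> (272/100) ^ 3" .
    moreover have "exp (2.9 :: real) * (1 + 0.1) \<le> exp 2.9 * exp 0.1"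
      by (intro mult_left_mono exp_ge_add_one_self) simp
    ultimately have "exp (2.9 :: real) * (1 + 0.1) \<le> (272/100) ^ 3" by (rule order_trans[rotated])
    then show ?thesis by (simp add: power3_eq_cube)
  qed
  have "?f 0 \<le> ?f (2 * z)"
  proof (rule DERIV_nonneg_imp_nondecreasing[of 0 "2 * z" ?f])
    fix u :: real
    have "(?f has_real_derivative (0.95 - 0.05 * ((3.9 - u) * exp u))) (at u)"
      by (auto intro!: derivative_eq_intros simp: field_simps)
    moreover have "(3.9 - u) * exp u \<le> 19"
    proof -
      have "(1 + (2.9 - u)) * exp u \<le> exp (2.9 - u) * exp u"
        by (intro mult_right_mono exp_ge_add_one_self) simp
      also have "\<dots> = exp 2.9" by (simp flip: exp_add)
      finally show ?thesis using e29 by simp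
    qed
    then have "0 \<le> 0.95 - 0.05 * ((3.9 - u) * exp u)" by simp
    ultimately show "\<exists>y. (?f has_real_derivative y) (at u) \<and> 0 \<le> y" by blast
  qed (use z in simp)
  then have f: "0 \<le> 2 * z - (0.245 - 0.1 * z) * (exp (2 * z) - 1)" by simp
  have "exp z * exp z = exp (2 * z)" "exp z * exp (- z) = 1" by (simp_all flip: exp_add)
  then have two: "2 * exp z * cosh z = exp (2 * z) + 1" "2 * exp z * sinh z = exp (2 * z) - 1"
    by (simp_all add: cosh_field_def sinh_field_def distrib_left right_diff_distrib mult.assoc)
  have "2 * exp z * (z * cosh z - (0.245 + 0.9 * z) * sinh z)
      = z * (2 * exp z * cosh z) - (0.245 + 0.9 * z) * (2 * exp z * sinh z)"
    by (simp add: algebra_simps)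
  also have "\<dots> = 2 * z - (0.245 - 0.1 * z) * (exp (2 * z) - 1)"
    unfolding two by (simp add: field_simps)
  finally have "2 * exp z * (z * cosh z - (0.245 + 0.9 * z) * sinh z) = 2 * z - (0.245 - 0.1 * z) * (exp (2 * z) - 1)" .
  with f have "0 \<le> 2 * exp z * (z * cosh z - (0.245 + 0.9 * z) * sinh z)" by simp
  then show ?thesis by (simp add: zero_le_mult_iff)
qed

lemma sinh_le_z_cosh: "sinh z \<le> z * cosh z" if z: "0 < z" for z :: real
proof -
  let ?f = "\<lambda>z::real. z * cosh z - sinh z"
  have "?f 0 \<le> ?f z"
  proof (rule DERIV_nonneg_imp_nondecreasing[of 0 z ?f])
    fix u :: real assume "0 \<le> u"
    moreover have "(?f has_real_derivative (u * sinh u)) (at u)"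
      by (auto intro!: derivative_eq_intros)
    ultimately show "\<exists>y. (?f has_real_derivative y) (at u) \<and> 0 \<le> y" by force
  qed (use z in simp)
  then show ?thesis by simp
qed

lemma zcsch_pos: "0 < zcsch z"
  by (auto simp: zcsch_def zero_less_divide_iff)

lemma zcsch_decay:
  assumes s: "0 < s" "s \<le> 1" and ab: "a = 0.9 \<and> b = 0.755 \<or> a = 0 \<and> b = 0"
  shows "zcsch x \<le> zcsch (s * x) * exp (b * ln (1 / s) - a * (1 - s) * \<bar>x\<bar>)"
proof (rule log_slope_decay[OF _ _ _ _ _ s])
  fix x :: real
  show "0 < zcsch x" "zcsch (- x) = zcsch x" by (simp_all add: zcsch_pos) (simp add: zcsch_def)
  assume x: "0 < x"
  have "((\<lambda>x. x / sinh x) has_real_derivative ((sinh x - x * cosh x) / (sinh x)\<^sup>2)) (at x)"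
    using x by (auto intro!: derivative_eq_intros simp: power2_eq_square)
  then show "(zcsch has_real_derivative ((sinh x - x * cosh x) / (sinh x)\<^sup>2)) (at x)"
    by (rule has_field_derivative_transform_within_open[where S = "{0<..}"]) (use x in \<open>auto simp: zcsch_def\<close>)
  have "(1 - b + a * x) * sinh x \<le> x * cosh x"
    using ab
  proof (elim disjE conjE)
    assume "a = 0.9" "b = 0.755"
    have "1 - b + a * x = 0.245 + 0.9 * x" unfolding \<open>a = 0.9\<close> \<open>b = 0.755\<close> by simp
    then show ?thesis using z_cosh_bound[OF x] by (simp only:)
  next
    assume "a = 0" "b = 0"
    then show ?thesis using sinh_le_z_cosh[OF x] by simp
  qed
  then have "sinh x - x * cosh x \<le> (b - a * x) * sinh x" by (simp add: algebra_simps)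
  then have "x / (sinh x)\<^sup>2 * (sinh x - x * cosh x) \<le> x / (sinh x)\<^sup>2 * ((b - a * x) * sinh x)"
    using x by (intro mult_left_mono) auto
  then show "x * ((sinh x - x * cosh x) / (sinh x)\<^sup>2) \<le> (b - a * x) * zcsch x"
    using x by (simp add: zcsch_def power2_eq_square mult_ac)
qed (use ab in auto)

definition sech_sq_hat :: "real \<Rightarrow> real" where "sech_sq_hat y = 2 * zcsch (pi\<^sup>2 * y)"

lemma sech_sq_hat_decay:
  assumes s: "0 < s" "s \<le> 1" and ab: "a = 0.9 * pi\<^sup>2 \<and> b = 0.755 \<or> a = 0 \<and> b = 0"
  shows "sech_sq_hat y \<le> sech_sq_hat (s * y) * exp (b * ln (1 / s) - a * (1 - s) * \<bar>y\<bar>)"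
proof -
  have "a / pi\<^sup>2 = 0.9 \<and> b = 0.755 \<or> a / pi\<^sup>2 = 0 \<and> b = 0" using ab by auto
  from zcsch_decay[OF s this, of "pi\<^sup>2 * y"] show ?thesis
    by (simp add: sech_sq_hat_def abs_mult mult_ac)
qed

text \<open>Equivalently \<open>cosh x \<le> exp \<bar>y\<bar> * cosh (x + y)\<close>, which the addition formula gives.\<close>
lemma sech_sq_harnack: "sech_sq (x + y) \<le> exp (2 * \<bar>y\<bar>) * sech_sq x"
proof -
  have "cosh x = cosh (x + y) * cosh y - sinh (x + y) * sinh y"
    using cosh_diff[of "x + y" y] by simp
  also have "\<dots> \<le> cosh (x + y) * cosh y + cosh (x + y) * \<bar>sinh y\<bar>"
  proof -
    have "\<bar>sinh t\<bar> \<le> cosh t" for t :: real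
      using sinh_less_cosh_real[of t] sinh_less_cosh_real[of "- t"] by (auto simp: abs_le_iff)
    then have "\<bar>sinh (x + y)\<bar> * \<bar>sinh y\<bar> \<le> cosh (x + y) * \<bar>sinh y\<bar>" by (rule mult_right_mono) simp
    then have "- (sinh (x + y) * sinh y) \<le> cosh (x + y) * \<bar>sinh y\<bar>"
      by (metis abs_ge_minus_self abs_mult order_trans)
    then show ?thesis by simp
  qed
  also have "\<dots> = exp \<bar>y\<bar> * cosh (x + y)"
    by (cases "0 \<le> y") (simp_all add: algebra_simps cosh_plus_sinh[symmetric] flip: distrib_left)
  finally have "(cosh x)\<^sup>2 \<le> (exp \<bar>y\<bar> * cosh (x + y))\<^sup>2" by (intro power_mono) auto
  also have "\<dots> = exp (2 * \<bar>y\<bar>) * (cosh (x + y))\<^sup>2" by (simp add: power_mult_distrib flip: exp_double)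
  finally show ?thesis by (simp add: sech_sq_def field_simps)
qed

section \<open>Tails of lattice sums\<close>

text \<open>Scaling one lattice by \<open>r\<close> divides the covolume of the dual one by the \<open>n\<close>-th power of \<open>r\<close>.\<close>
lemma density_scaleR_distr:
  fixes T :: "real ^ 'n \<Rightarrow> real ^ 'n"
  assumes "linear T" and D: "0 < D" and distr: "distr lborel borel T = density lborel (\<lambda>_. ennreal D)" and r: "0 < r"
  shows "distr lborel borel (\<lambda>w. r *\<^sub>R T w) = density lborel (\<lambda>_. ennreal (D / r ^ CARD('n)))"
proof (rule measure_eqI)
  have [measurable]: "T \<in> borel_measurable borel"
    by (intro borel_measurable_continuous_onI linear_continuous_on) (use assms(1) linear_conv_bounded_linear in blast)
  fix X assume "X \<in> sets (distr lborel borel (\<lambda>w. r *\<^sub>R T w))"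
  then have X[measurable]: "X \<in> sets borel" by simp
  have "emeasure (distr lborel borel (\<lambda>w. r *\<^sub>R T w)) X = (\<integral>\<^sup>+w. indicator X (r *\<^sub>R T w) \<partial>lborel)"
    using nn_integral_distr[of "\<lambda>w. r *\<^sub>R T w" lborel borel "indicator X"] by simp
  also have "\<dots> = (\<integral>\<^sup>+x. indicator X (r *\<^sub>R x) \<partial>distr lborel borel T)"
    by (subst nn_integral_distr) auto
  also have "\<dots> = ennreal D * (\<integral>\<^sup>+x. indicator X (r *\<^sub>R x) \<partial>lborel)"
    unfolding distr by (subst nn_integral_density) (auto simp: nn_integral_cmult)
  also have "(\<integral>\<^sup>+x. indicator X (r *\<^sub>R x) \<partial>lborel) = ennreal (1 / r ^ CARD('n)) * emeasure lborel X"
  proof -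
    have "emeasure lborel X = ennreal (r ^ CARD('n)) * (\<integral>\<^sup>+x. indicator X (r *\<^sub>R x) \<partial>lborel)"
      using nn_integral_lborel_scaleR[of r "indicator X"] r by simp
    then have "ennreal (1 / r ^ CARD('n)) * emeasure lborel X
        = (ennreal (1 / r ^ CARD('n)) * ennreal (r ^ CARD('n))) * (\<integral>\<^sup>+x. indicator X (r *\<^sub>R x) \<partial>lborel)"
      by (simp add: mult.assoc)
    also have "ennreal (1 / r ^ CARD('n)) * ennreal (r ^ CARD('n)) = 1"
      using r by (simp flip: ennreal_mult')
    finally show ?thesis by simp
  qed
  also have "ennreal D * (ennreal (1 / r ^ CARD('n)) * emeasure lborel X) = ennreal (D / r ^ CARD('n)) * emeasure lborel X"
    using D r by (simp add: mult.assoc[symmetric] flip: ennreal_mult')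
  finally show "emeasure (distr lborel borel (\<lambda>w. r *\<^sub>R T w)) X
      = emeasure (density lborel (\<lambda>_. ennreal (D / r ^ CARD('n)))) X"
    by (simp add: emeasure_density_const)
qed simp

text \<open>Here \<open>(a, b)\<close> and \<open>(ah, bh)\<close> are the decay parameters of \<open>g\<close> and \<open>gh\<close> under scaling.\<close>
locale decaying_poisson = poisson_setting g gh A T S D
  for g gh :: "real \<Rightarrow> real" and A :: real and T S :: "real ^ 'n \<Rightarrow> real ^ 'n" and D :: real +
  fixes a b ah bh :: real
  assumes g_decay: "0 < s \<Longrightarrow> s \<le> 1 \<Longrightarrow> g x \<le> g (s * x) * exp (b * ln (1 / s) - a * (1 - s) * \<bar>x\<bar>)"
    and g_mono: "0 < s \<Longrightarrow> s \<le> 1 \<Longrightarrow> g x \<le> g (s * x)"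
    and gh_decay: "0 < s \<Longrightarrow> s \<le> 1 \<Longrightarrow> gh y \<le> gh (s * y) * exp (bh * ln (1 / s) - ah * (1 - s) * \<bar>y\<bar>)"
    and gh_mono: "0 < s \<Longrightarrow> s \<le> 1 \<Longrightarrow> gh y \<le> gh (s * y)"
    and a_pos: "0 < a" "0 < ah"
begin

lemma scaled_setting:
  assumes r: "0 < r"
  shows "poisson_setting g gh A (\<lambda>w. r *\<^sub>R T w) (\<lambda>w. (1 / r) *\<^sub>R S w) (D / r ^ CARD('n))"
proof (rule poisson_setting.intro)
  show "linear (\<lambda>w. r *\<^sub>R T w)" "linear (\<lambda>w. (1 / r) *\<^sub>R S w)"
    using lin lin_S by (auto intro: linear_compose_scale_right)
  fix w z
  show "(r *\<^sub>R T w) \<bullet> ((1 / r) *\<^sub>R S z) = w \<bullet> z" using r by (simp add: dual)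
next
  show "0 < D / r ^ CARD('n)" using D_pos r by simp
  show "distr lborel borel (\<lambda>w. r *\<^sub>R T w) = density lborel (\<lambda>_. ennreal (D / r ^ CARD('n)))"
    by (rule density_scaleR_distr[OF lin D_pos distr_T r])
qed (rule g_pos g_cont A_nonneg g_harnack g_int gh_nonneg g_fourier)+

lemma G_scale_mono: "0 < s \<Longrightarrow> s \<le> 1 \<Longrightarrow> G x \<le> G (s *\<^sub>R x)"
  using tensor_mono_factor[of g s 0 0 x] g_mono g_pos by (simp add: less_imp_le)

lemma Gh_scale_mono: "0 < s \<Longrightarrow> s \<le> 1 \<Longrightarrow> Gh y \<le> Gh (s *\<^sub>R y)"
  using tensor_mono_factor[of gh s 0 0 y] gh_mono gh_nonneg by simp

lemma Gh_summable: "(\<lambda>k. Gh (S (ivec k))) summable_on UNIV"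
  and \<theta>_0_eq: "\<theta> 0 = D * (\<Sum>\<^sub>\<infinity>k. Gh (S (ivec k)))"
proof -
  show "(\<lambda>k. Gh (S (ivec k))) summable_on UNIV"
    using has_sum_imp_summable[OF poisson_at_0] D_pos by (simp add: summable_on_cmult_right')
  then show "\<theta> 0 = D * (\<Sum>\<^sub>\<infinity>k. Gh (S (ivec k)))"
    using infsumI[OF poisson_at_0] by (simp add: infsum_cmult_right)
qed

lemma \<theta>_le_\<theta>_0: "\<theta> v \<le> \<theta> 0"
  using poisson_deviation[of v] by linarith

lemma \<theta>_pos: "0 < \<theta> v"
proof -
  have "G (T (ivec (\<lambda>_. 0)) + v) = (\<Sum>\<^sub>\<infinity>k\<in>{\<lambda>_. 0}. G (T (ivec k) + v))" by simp
  also have "\<dots> \<le> \<theta> v"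
    unfolding lattice_sum_def
    by (rule infsum_mono2) (auto intro: orbit_summable simp: G_pos less_imp_le)
  finally show ?thesis using G_pos by (rule less_le_trans[rotated])
qed

text \<open>The scale \<open>1 / l\<close> is optimal at distance \<open>(1 + \<beta>) / \<alpha> * n * l\<close>, since \<open>(1 - 1 / l) * l = l - 1\<close>. The
  denominator \<open>exp (n * ln l)\<close>, which is the \<open>n\<close>-th power of \<open>l\<close>, pays for the rescaling of the lattice.\<close>
lemma tail_exponent:
  fixes n l c \<beta> \<alpha> :: real
  assumes "1 \<le> l" "0 < \<alpha>" "c \<ge> (1 + \<beta>) / \<alpha> * n * l"
  shows "exp (n * (\<beta> * ln l) - \<alpha> * (1 - 1 / l) * c) \<le> exp (- (1 + \<beta>) * n * (l - 1 - ln l)) / exp (n * ln l)"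
proof -
  have "(1 - 1 / l) * l = l - 1" using assms(1) by (simp add: field_simps)
  then have "\<alpha> * (1 - 1 / l) * ((1 + \<beta>) / \<alpha> * n * l) = (1 + \<beta>) * n * (l - 1)"
  proof -
    have "\<alpha> * (1 - 1 / l) * ((1 + \<beta>) / \<alpha> * n * l) = (\<alpha> * ((1 + \<beta>) / \<alpha>)) * n * ((1 - 1 / l) * l)"
      by (simp only: mult_ac)
    with \<open>(1 - 1 / l) * l = l - 1\<close> assms(2) show ?thesis by simp
  qed
  moreover have "\<alpha> * (1 - 1 / l) * ((1 + \<beta>) / \<alpha> * n * l) \<le> \<alpha> * (1 - 1 / l) * c"
    using assms by (intro mult_left_mono) auto
  ultimately have "n * (\<beta> * ln l) - \<alpha> * (1 - 1 / l) * c \<le> - (1 + \<beta>) * n * (l - 1 - ln l) - n * ln l"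
    by (simp add: algebra_simps)
  then show ?thesis by (simp flip: exp_diff)
qed

text \<open>Shrinking the lattice by \<open>s = 1 / l\<close> multiplies \<open>\<theta> 0\<close> by at most the \<open>n\<close>-th power of \<open>l\<close>: on the dual
  side the frequencies are stretched, which decreases every value of \<open>Gh\<close>, and only the covolume grows.
  Shifting a lattice sum away from the origin does not increase it.\<close>
lemma shifted_tail:
  assumes l: "1 \<le> l" and far: "\<And>k. (1 + b) / a * real CARD('n) * l \<le> l1_norm (T (ivec k) + v)"
  shows "\<theta> v \<le> exp (- (1 + b) * real CARD('n) * (l - 1 - ln l)) * \<theta> 0"
proof -
  define n where "n = real CARD('n)"
  define s where "s = 1 / l"
  have s: "0 < s" "s \<le> 1" "1 / s = l" and sl: "s * l = 1" using l by (auto simp: s_def)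
  define E where "E = exp (- (1 + b) * n * (l - 1 - ln l))"
  interpret Z: poisson_setting g gh A "\<lambda>w. s *\<^sub>R T w" "\<lambda>w. (1 / s) *\<^sub>R S w" "D / s ^ CARD('n)"
    by (rule scaled_setting) (rule s)
  interpret Z: decaying_poisson g gh A "\<lambda>w. s *\<^sub>R T w" "\<lambda>w. (1 / s) *\<^sub>R S w" "D / s ^ CARD('n)" a b ah bh
    by standard (rule g_decay g_mono gh_decay gh_mono a_pos; assumption)+
  have ln_exp: "exp (n * ln l) = l ^ CARD('n)"
    using l by (simp add: n_def exp_of_nat_mult)
  have summand: "G (T (ivec k) + v) \<le> E / l ^ CARD('n) * G (s *\<^sub>R T (ivec k) + s *\<^sub>R v)" for k
  proof -
    let ?x = "T (ivec k) + v"
    have "G ?x \<le> G (s *\<^sub>R ?x) * exp (n * (b * ln l) - a * (1 - s) * l1_norm ?x)"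
      unfolding n_def s(3)[symmetric] by (rule tensor_mono_factor) (auto intro: g_decay s simp: g_pos less_imp_le)
    also have "\<dots> \<le> G (s *\<^sub>R ?x) * (E / exp (n * ln l))"
      unfolding E_def s_def
      by (intro mult_left_mono tail_exponent l a_pos) (use far[of k] in \<open>auto simp: n_def G_pos less_imp_le\<close>)
    finally show ?thesis by (simp add: ln_exp scaleR_add_right mult.commute)
  qed
  have "\<theta> v \<le> (\<Sum>\<^sub>\<infinity>k. E / l ^ CARD('n) * G (s *\<^sub>R T (ivec k) + s *\<^sub>R v))"
    unfolding lattice_sum_def
    by (intro infsum_mono orbit_summable summable_on_cmult_right Z.orbit_summable) (rule summand)
  also have "\<dots> = E / l ^ CARD('n) * Z.\<theta> (s *\<^sub>R v)"
    unfolding lattice_sum_def by (intro infsum_cmult_right Z.orbit_summable)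
  also have "\<dots> \<le> E / l ^ CARD('n) * Z.\<theta> 0"
    using l by (intro mult_left_mono Z.\<theta>_le_\<theta>_0) (auto simp: E_def)
  also have "\<dots> \<le> E / l ^ CARD('n) * (l ^ CARD('n) * \<theta> 0)"
  proof (rule mult_left_mono)
    have "Gh ((1 / s) *\<^sub>R S (ivec k)) \<le> Gh (S (ivec k))" for k
      using Gh_scale_mono[OF s(1,2), of "(1 / s) *\<^sub>R S (ivec k)"] s sl by simp
    then have "(\<Sum>\<^sub>\<infinity>k. Gh ((1 / s) *\<^sub>R S (ivec k))) \<le> (\<Sum>\<^sub>\<infinity>k. Gh (S (ivec k)))"
      by (intro infsum_mono Z.Gh_summable Gh_summable)
    then have "D * l ^ CARD('n) * (\<Sum>\<^sub>\<infinity>k. Gh ((1 / s) *\<^sub>R S (ivec k))) \<le> D * l ^ CARD('n) * (\<Sum>\<^sub>\<infinity>k. Gh (S (ivec k)))"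
      using D_pos l by (intro mult_left_mono) auto
    then show "Z.\<theta> 0 \<le> l ^ CARD('n) * \<theta> 0"
      unfolding Z.\<theta>_0_eq \<theta>_0_eq by (simp add: s_def power_one_over mult_ac)
  qed (use l in \<open>simp add: E_def\<close>)
  also have "\<dots> = E * \<theta> 0" using l by simp
  finally show ?thesis by (simp only: E_def n_def)
qed

text \<open>The same comparison on the frequency side. Contracting the frequencies by \<open>s = 1 / l\<close> amounts to
  stretching the lattice \<open>T (\<int>\<^sup>n)\<close> by \<open>l\<close>, which decreases every value of \<open>G\<close>.\<close>
lemma nonzero_tail:
  assumes l: "1 \<le> l" and far: "\<And>k. k \<noteq> (\<lambda>_. 0) \<Longrightarrow> (1 + bh) / ah * real CARD('n) * l \<le> l1_norm (S (ivec k))"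
  shows "\<theta> 0 - D * Gh 0 \<le> exp (- (1 + bh) * real CARD('n) * (l - 1 - ln l)) * \<theta> 0"
proof -
  define n where "n = real CARD('n)"
  define s where "s = 1 / l"
  have s: "0 < s" "s \<le> 1" "1 / s = l" and sl: "s * l = 1" using l by (auto simp: s_def)
  define E where "E = exp (- (1 + bh) * n * (l - 1 - ln l))"
  have lpos: "0 < l" using l by simp
  interpret Z: poisson_setting g gh A "\<lambda>w. l *\<^sub>R T w" "\<lambda>w. (1 / l) *\<^sub>R S w" "D / l ^ CARD('n)"
    by (rule scaled_setting) (rule lpos)
  interpret Z: decaying_poisson g gh A "\<lambda>w. l *\<^sub>R T w" "\<lambda>w. (1 / l) *\<^sub>R S w" "D / l ^ CARD('n)" a b ah bh
    by standard (rule g_decay g_mono gh_decay gh_mono a_pos; assumption)+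
  have ln_exp: "exp (n * ln l) = l ^ CARD('n)"
    using l by (simp add: n_def exp_of_nat_mult)
  let ?z = "(\<lambda>_. 0) :: 'n \<Rightarrow> int"
  have z: "S (ivec ?z) = 0"
  proof -
    have "ivec ?z = 0" by (simp add: vec_eq_iff)
    then show ?thesis by (simp add: linear_0[OF lin_S])
  qed
  have summand: "Gh (S (ivec k)) \<le> E / l ^ CARD('n) * Gh (s *\<^sub>R S (ivec k))" if "k \<noteq> ?z" for k
  proof -
    let ?y = "S (ivec k)"
    have "Gh ?y \<le> Gh (s *\<^sub>R ?y) * exp (n * (bh * ln l) - ah * (1 - s) * l1_norm ?y)"
      unfolding n_def s(3)[symmetric] by (rule tensor_mono_factor) (auto intro: gh_decay s gh_nonneg)
    also have "\<dots> \<le> Gh (s *\<^sub>R ?y) * (E / exp (n * ln l))"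
      unfolding E_def s_def
      by (intro mult_left_mono tail_exponent l a_pos Gh_nonneg) (use far[OF that] in \<open>simp add: n_def\<close>)
    finally show ?thesis by (simp add: ln_exp mult.commute)
  qed
  have ZS: "(\<lambda>k. E / l ^ CARD('n) * Gh (s *\<^sub>R S (ivec k))) summable_on UNIV"
    using Z.Gh_summable unfolding s_def by (rule summable_on_cmult_right)
  have Z0: "0 \<le> E / l ^ CARD('n) * Gh (s *\<^sub>R S (ivec k))" for k
    using lpos by (intro mult_nonneg_nonneg Gh_nonneg) (simp add: E_def)
  have split: "\<theta> 0 - D * Gh 0 = D * (\<Sum>\<^sub>\<infinity>k\<in>-{?z}. Gh (S (ivec k)))"
  proof -
    have "(\<Sum>\<^sub>\<infinity>k. Gh (S (ivec k))) = (\<Sum>\<^sub>\<infinity>k\<in>{?z} \<union> -{?z}. Gh (S (ivec k)))" by simp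
    also have "\<dots> = (\<Sum>\<^sub>\<infinity>k\<in>{?z}. Gh (S (ivec k))) + (\<Sum>\<^sub>\<infinity>k\<in>-{?z}. Gh (S (ivec k)))"
      by (rule infsum_Un_disjoint) (auto intro: summable_on_subset_banach[OF Gh_summable])
    finally show ?thesis unfolding \<theta>_0_eq by (simp add: z algebra_simps)
  qed
  have "(\<Sum>\<^sub>\<infinity>k\<in>-{?z}. Gh (S (ivec k))) \<le> (\<Sum>\<^sub>\<infinity>k\<in>-{?z}. E / l ^ CARD('n) * Gh (s *\<^sub>R S (ivec k)))"
    by (intro infsum_mono summable_on_subset_banach[OF Gh_summable] summand
        summable_on_subset_banach[OF ZS]) auto
  also have "\<dots> \<le> (\<Sum>\<^sub>\<infinity>k. E / l ^ CARD('n) * Gh (s *\<^sub>R S (ivec k)))"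
    by (rule infsum_mono2[OF summable_on_subset_banach[OF ZS] ZS]) (use Z0 in auto)
  also have "\<dots> = E / l ^ CARD('n) * (\<Sum>\<^sub>\<infinity>k. Gh (s *\<^sub>R S (ivec k)))"
    by (intro infsum_cmult_right Z.Gh_summable[folded s_def])
  finally have "\<theta> 0 - D * Gh 0 \<le> D * (E / l ^ CARD('n) * (\<Sum>\<^sub>\<infinity>k. Gh (s *\<^sub>R S (ivec k))))"
    unfolding split using D_pos by (intro mult_left_mono) auto
  also have "\<dots> = E * Z.\<theta> 0"
    unfolding Z.\<theta>_0_eq by (simp add: s_def)
  also have "\<dots> \<le> E * \<theta> 0"
  proof (rule mult_left_mono)
    show "Z.\<theta> 0 \<le> \<theta> 0"
      unfolding lattice_sum_def
    proof (intro infsum_mono Z.orbit_summable orbit_summable)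
      fix k
      show "G (l *\<^sub>R T (ivec k) + 0) \<le> G (T (ivec k) + 0)"
        using G_scale_mono[OF s(1,2), of "l *\<^sub>R T (ivec k)"] sl by simp
    qed
  qed (simp add: E_def)
  finally show ?thesis by (simp only: E_def n_def)
qed

text \<open>If both tails are below a third of \<open>\<theta> 0\<close>, then \<open>\<theta> v < \<theta> 0 / 3\<close> although
  \<open>\<theta> v \<ge> D * Gh 0 - (\<theta> 0 - D * Gh 0) > \<theta> 0 / 3\<close>.\<close>
theorem no_gap_in_both:
  assumes l: "1 \<le> l"
    and far: "\<And>k. (1 + b) / a * real CARD('n) * l \<le> l1_norm (T (ivec k) + v)"
    and far_dual: "\<And>k. k \<noteq> (\<lambda>_. 0) \<Longrightarrow> (1 + bh) / ah * real CARD('n) * l \<le> l1_norm (S (ivec k))"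
    and b: "0 \<le> b" "0 \<le> bh" and big: "3 < exp (real CARD('n) * (l - 1 - ln l))"
  shows False
proof -
  define n where "n = real CARD('n)"
  have small: "exp (- (1 + c) * n * (l - 1 - ln l)) < 1 / 3" if "0 \<le> c" for c
  proof -
    have "0 \<le> n * (l - 1 - ln l)" using ln_le_minus_one[of l] l by (simp add: n_def)
    then have "0 \<le> c * (n * (l - 1 - ln l))" using that by simp
    then have "- (1 + c) * n * (l - 1 - ln l) \<le> - (n * (l - 1 - ln l))" by (simp add: algebra_simps)
    then have "exp (- (1 + c) * n * (l - 1 - ln l)) \<le> inverse (exp (n * (l - 1 - ln l)))"
      by (simp flip: exp_minus)
    also have "\<dots> < 1 / 3" using big by (simp add: n_def field_simps)
    finally show ?thesis .
  qed
  have "\<theta> v \<le> exp (- (1 + b) * n * (l - 1 - ln l)) * \<theta> 0"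
    unfolding n_def by (rule shifted_tail[OF l far])
  also have "\<dots> < 1 / 3 * \<theta> 0" by (rule mult_strict_right_mono[OF small[OF b(1)] \<theta>_pos])
  finally have 1: "\<theta> v < 1 / 3 * \<theta> 0" .
  have "\<theta> 0 - D * Gh 0 \<le> exp (- (1 + bh) * n * (l - 1 - ln l)) * \<theta> 0"
    unfolding n_def by (rule nonzero_tail[OF l far_dual])
  also have "\<dots> < 1 / 3 * \<theta> 0" by (rule mult_strict_right_mono[OF small[OF b(2)] \<theta>_pos])
  finally have 2: "\<theta> 0 - D * Gh 0 < 1 / 3 * \<theta> 0" .
  show False using 1 2 poisson_deviation[of v] by linarith
qed

end


section \<open>The transference bound\<close>

text \<open>If \<open>f\<close> carries the integer vectors onto a lattice, then the inverse transpose of \<open>f\<close> carries them into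
  the dual lattice.\<close>
lemma dual_basis_map:
  fixes f :: "real ^ 'n \<Rightarrow> real ^ 'n"
  assumes f: "linear f" "inj f" "surj f"
  obtains T D where "linear T" "\<And>x y. T x \<bullet> f y = x \<bullet> y" "0 < D"
    "distr lborel borel T = density lborel (\<lambda>_. ennreal D)"
proof -
  define T where "T = adjoint (inv f)"
  have inv: "linear (inv f)" by (rule inj_linear_imp_inv_linear[OF f(1,2)])
  have lin: "linear T" "linear (adjoint f)"
    unfolding T_def by (intro adjoint_linear inv f)+
  have dual: "T x \<bullet> f y = x \<bullet> y" for x y
    using adjoint_works[OF inv, of "f y" x] f(2) by (simp add: T_def inner_commute)
  have adj: "adjoint f x \<bullet> y = x \<bullet> f y" for x y
    using adjoint_works[OF f(1), of y x] by (simp add: inner_commute)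
  have "adjoint f (T x) = x" for x
  proof -
    have "adjoint f (T x) \<bullet> y = x \<bullet> y" for y by (simp add: adj dual)
    then show ?thesis by (metis inner_commute vector_eq_ldot)
  qed
  moreover have "T (adjoint f x) = x" for x
  proof -
    have "T (adjoint f x) \<bullet> y = x \<bullet> y" for y
      using dual[of "adjoint f x" "inv f y"] adj[of x "inv f y"] f(3) by (simp add: surj_f_inv_f)
    then show ?thesis by (metis inner_commute vector_eq_ldot)
  qed
  ultimately obtain D where "0 < D" "distr lborel borel T = density lborel (\<lambda>_. ennreal D)"
    using distr_lborel_linear[OF lin] by metis
  then show thesis using that lin(1) dual by blast
qed

lemma decaying_poisson_sech_sq:
  assumes "linear T" "linear S" "\<And>x y. T x \<bullet> S y = x \<bullet> y" "0 < D"
    "distr lborel borel T = density lborel (\<lambda>_. ennreal D)"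
  shows "decaying_poisson sech_sq sech_sq_hat 2 T S D 2 0.56 (0.9 * pi\<^sup>2) 0.755"
proof (intro decaying_poisson.intro poisson_setting.intro decaying_poisson_axioms.intro)
  show "continuous_on UNIV sech_sq" unfolding sech_sq_def[abs_def] by (auto intro!: continuous_intros)
  show "integrable lborel sech_sq" unfolding sech_sq_def[abs_def] by (rule integrable_sech_sq)
  show "sech_sq (x + y) \<le> exp (2 * \<bar>y\<bar>) * sech_sq x" for x y by (rule sech_sq_harnack)
  show "(\<integral>x. cis (2 * pi * (x * y)) * of_real (sech_sq x) \<partial>lborel) = of_real (sech_sq_hat y)" for y
    using fourier_sech_sq[of y] by (simp add: sech_sq_def sech_sq_hat_def)
  fix s x :: real assume s: "0 < s" "s \<le> 1"
  show "sech_sq x \<le> sech_sq (s * x) * exp (0.56 * ln (1 / s) - 2 * (1 - s) * \<bar>x\<bar>)"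
    by (rule sech_sq_decay[OF s]) simp
  show "sech_sq x \<le> sech_sq (s * x)" using sech_sq_decay[OF s, of 0 0 x] by simp
  show "sech_sq_hat x \<le> sech_sq_hat (s * x) * exp (0.755 * ln (1 / s) - 0.9 * pi\<^sup>2 * (1 - s) * \<bar>x\<bar>)"
    by (rule sech_sq_hat_decay[OF s]) simp
  show "sech_sq_hat x \<le> sech_sq_hat (s * x)" using sech_sq_hat_decay[OF s, of 0 0 x] by simp
qed (use assms in \<open>auto simp: sech_sq_def sech_sq_hat_def zcsch_pos less_imp_le\<close>)

text \<open>The product of both quantities is invariant under scaling of the lattice. If it were too large, then a
  scaling by \<open>r\<close> would bring the shortest length to exactly \<open>1.95 / \<pi>\<^sup>2 * n * l\<close> and the covering radius
  to at least \<open>0.78 * n * l\<close>, where \<open>l = (1 + 2 / sqrt n)\<^sup>2\<close>. Writing \<open>l\<close> as a square makes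
  \<open>n (l - 1 - ln l) \<ge> 4\<close> immediate from \<open>ln (1 + t) \<le> t\<close>.\<close>
theorem sigma1_rho1_bound:
  fixes L :: "(real ^ 'n) set"
  assumes L: "is_lattice L"
  shows "sigma1 L * rho1 (dual_lattice L)
    < 1.521 / pi\<^sup>2 * (real CARD('n))\<^sup>2 * (1 + 2 / sqrt (real CARD('n))) ^ 4"
proof (rule ccontr)
  define n where "n = real CARD('n)"
  define l where "l = (1 + 2 / sqrt n)\<^sup>2"
  define \<sigma> where "\<sigma> = sigma1 L"
  define \<rho> where "\<rho> = rho1 (dual_lattice L)"
  have n: "1 \<le> n" unfolding n_def by simp
  have sq: "0 < sqrt n" "sqrt n * sqrt n = n" using n by auto
  have l1: "1 \<le> l" unfolding l_def using sq by (intro one_le_power) auto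
  assume "\<not> sigma1 L * rho1 (dual_lattice L) < 1.521 / pi\<^sup>2 * (real CARD('n))\<^sup>2 * (1 + 2 / sqrt (real CARD('n))) ^ 4"
  then have big: "1.521 / pi\<^sup>2 * n\<^sup>2 * l\<^sup>2 \<le> \<sigma> * \<rho>"
    by (simp add: \<sigma>_def \<rho>_def n_def l_def flip: power_mult)
  obtain f :: "real ^ 'n \<Rightarrow> real ^ 'n" where f: "linear f" "inj f" "surj f" "L = f ` int_vecs"
    by (rule is_lattice_linear_image[OF L])
  obtain T D where T: "linear T" "\<And>x y. T x \<bullet> f y = x \<bullet> y" "0 < D"
    "distr lborel borel T = density lborel (\<lambda>_. ennreal D)"
    by (rule dual_basis_map[OF f(1-3)]) (rule that)
  have ivec_int: "ivec k \<in> int_vecs" for k :: "'n \<Rightarrow> int" by (simp add: int_vecs_def)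
  obtain v where v: "\<rho> = dist1 (dual_lattice L) v" using rho1_attained[OF L] \<rho>_def by auto
  have \<rho>: "\<rho> \<le> l1_norm (T (ivec k) - v)" for k
  proof -
    have "T (ivec k) \<bullet> f z \<in> \<int>" if "z \<in> int_vecs" for z
      unfolding T(2) using that by (auto simp: inner_vec_def int_vecs_def intro!: Ints_sum Ints_mult)
    then have "T (ivec k) \<in> dual_lattice L" by (auto simp: dual_lattice_def f(4))
    then show ?thesis unfolding v using dist1_attained[OF L, of v] by metis
  qed
  obtain m where m: "m \<in> L - {0}" "\<sigma> = l1_norm m" and least: "\<And>x. x \<in> L - {0} \<Longrightarrow> l1_norm m \<le> l1_norm x"
    using sigma1_attained[OF L] unfolding \<sigma>_def by blast
  have \<sigma>: "\<sigma> \<le> l1_norm (f (ivec k))" if "k \<noteq> (\<lambda>_. 0)" for k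
  proof -
    have "ivec k \<noteq> 0" using that by (auto simp: vec_eq_iff)
    then have "f (ivec k) \<noteq> 0" using f(1,2) by (metis linear_injective_0)
    then show ?thesis using least[of "f (ivec k)"] ivec_int f(4) m(2) by auto
  qed
  have \<sigma>_pos: "0 < \<sigma>"
  proof -
    have "norm m \<le> l1_norm m" using norm_le_l1_cart[of m] by (simp add: l1_norm_def)
    then show ?thesis using m by (auto intro: less_le_trans[of 0 "norm m"])
  qed
  define r where "r = 1.95 / pi\<^sup>2 * n * l / \<sigma>"
  have r: "0 < r" unfolding r_def using n l1 \<sigma>_pos by simp
  interpret P: decaying_poisson sech_sq sech_sq_hat 2 T f D 2 "0.56" "0.9 * pi\<^sup>2" "0.755"
    by (rule decaying_poisson_sech_sq[OF T(1) f(1) T(2-4)])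
  interpret Q: poisson_setting sech_sq sech_sq_hat 2 "\<lambda>w. (1 / r) *\<^sub>R T w" "\<lambda>w. (1 / (1 / r)) *\<^sub>R f w" "D / (1 / r) ^ CARD('n)"
    by (rule P.scaled_setting) (use r in simp)
  interpret Q: decaying_poisson sech_sq sech_sq_hat 2 "\<lambda>w. (1 / r) *\<^sub>R T w" "\<lambda>w. (1 / (1 / r)) *\<^sub>R f w" "D / (1 / r) ^ CARD('n)"
      2 "0.56" "0.9 * pi\<^sup>2" "0.755"
    by standard (rule P.g_decay P.g_mono P.gh_decay P.gh_mono P.a_pos; assumption)+
  show False
  proof (rule Q.no_gap_in_both[OF l1])
    fix k :: "'n \<Rightarrow> int"
    show "(1 + 0.56) / 2 * real CARD('n) * l \<le> l1_norm ((1 / r) *\<^sub>R T (ivec k) + - ((1 / r) *\<^sub>R v))"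
    proof -
      have "(1 / r) *\<^sub>R T (ivec k) + - ((1 / r) *\<^sub>R v) = (1 / r) *\<^sub>R (T (ivec k) - v)"
        by (simp add: scaleR_diff_right)
      then have "l1_norm ((1 / r) *\<^sub>R T (ivec k) + - ((1 / r) *\<^sub>R v)) = l1_norm (T (ivec k) - v) / r"
        using r by simp
      moreover have "0.78 * n * l * r \<le> \<rho>"
      proof -
        have "0.78 * n * l * r = 1.521 / pi\<^sup>2 * n\<^sup>2 * l\<^sup>2 / \<sigma>"
          by (simp add: r_def power2_eq_square mult_ac)
        also have "\<dots> \<le> \<rho>" using big \<sigma>_pos by (simp add: field_simps)
        finally show ?thesis .
      qed
      then have "0.78 * n * l * r \<le> l1_norm (T (ivec k) - v)" using \<rho>[of k] by linarith
      then have "0.78 * n * l \<le> l1_norm (T (ivec k) - v) / r" using r by (simp add: field_simps)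
      ultimately show ?thesis by (simp add: n_def)
    qed
  next
    fix k :: "'n \<Rightarrow> int" assume k: "k \<noteq> (\<lambda>_. 0)"
    have "(1 + 0.755) / (0.9 * pi\<^sup>2) * real CARD('n) * l = r * \<sigma>"
      using \<sigma>_pos by (simp add: r_def n_def field_simps)
    also have "\<dots> \<le> r * l1_norm (f (ivec k))" using \<sigma>[OF k] r by simp
    finally show "(1 + 0.755) / (0.9 * pi\<^sup>2) * real CARD('n) * l \<le> l1_norm ((1 / (1 / r)) *\<^sub>R f (ivec k))"
      using r by simp
  next
    have "ln l \<le> 2 * (2 / sqrt n)"
    proof -
      have "ln l = 2 * ln (1 + 2 / sqrt n)" using sq by (simp add: l_def ln_realpow add_pos_pos)
      also have "\<dots> \<le> 2 * (2 / sqrt n)" using sq by (intro mult_left_mono ln_add_one_self_le_self) auto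
      finally show ?thesis .
    qed
    then have "(2 / sqrt n)\<^sup>2 \<le> l - 1 - ln l" by (simp add: l_def power2_sum)
    then have "n * (2 / sqrt n)\<^sup>2 \<le> n * (l - 1 - ln l)" using n by (intro mult_left_mono) auto
    moreover have "n * (2 / sqrt n)\<^sup>2 = 4" using n by (simp add: power_divide)
    ultimately have "4 \<le> n * (l - 1 - ln l)" by simp
    then show "3 < exp (real CARD('n) * (l - 1 - ln l))"
      using exp_ge_add_one_self[of "n * (l - 1 - ln l)"] unfolding n_def by linarith
  qed auto
qed

theorem theorem3p9:
  fixes L :: "(real ^ 'n) set"
  assumes "is_lattice L"
  shows "sigma1 L * rho1 (dual_lattice L)
           < 0.154264 * (real CARD('n))\<^sup>2 * (1 + 2 * pi * sqrt (3 / real CARD('n)))\<^sup>2"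
proof -
  define n where "n = real CARD('n)"
  have n: "1 \<le> n" unfolding n_def by simp
  have "sigma1 L * rho1 (dual_lattice L) < 1.521 / pi\<^sup>2 * n\<^sup>2 * (1 + 2 / sqrt n) ^ 4"
    unfolding n_def by (rule sigma1_rho1_bound[OF assms])
  also have "\<dots> \<le> 0.154264 * n\<^sup>2 * (1 + 2 * pi * sqrt (3 / n))\<^sup>2"
  proof (intro mult_mono)
    have "3.141\<^sup>2 \<le> pi\<^sup>2" using pi_approx(1) by (intro power_mono) auto
    then show "1.521 / pi\<^sup>2 \<le> 0.154264" by (simp add: field_simps power2_eq_square)
    have "(1 + 2 / sqrt n)\<^sup>2 \<le> 1 + 2 * pi * sqrt (3 / n)"
    proof -
      have "(1 + 2 / sqrt n)\<^sup>2 = 1 + 4 / sqrt n + 4 / n"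
        using n by (simp add: power2_sum power_divide)
      also have "4 / n \<le> 4 / sqrt n"
      proof (rule divide_left_mono)
        show "sqrt n \<le> n" using mult_left_mono[of 1 "sqrt n" "sqrt n"] n by simp
      qed (use n in auto)
      also have "1 + 4 / sqrt n + 4 / sqrt n \<le> 1 + 2 * pi * (sqrt 3 / sqrt n)"
      proof -
        have "4 \<le> pi * sqrt 3"
          using mult_mono[of 3 pi "4/3" "sqrt 3"] pi_gt3 real_le_rsqrt[of "4/3" 3]
          by (simp add: power2_eq_square)
        then have "8 / sqrt n \<le> 2 * (pi * sqrt 3) / sqrt n" using n by (intro divide_right_mono) auto
        then show ?thesis by simp
      qed
      finally show ?thesis by (simp add: real_sqrt_divide)
    qed
    then have "((1 + 2 / sqrt n)\<^sup>2)\<^sup>2 \<le> (1 + 2 * pi * sqrt (3 / n))\<^sup>2" by (intro power_mono) auto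
    then show "(1 + 2 / sqrt n) ^ 4 \<le> (1 + 2 * pi * sqrt (3 / n))\<^sup>2" by (simp flip: power_mult)
  qed auto
  finally show ?thesis unfolding n_def .
qed

end
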